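(* Let $(A,C)_\psi$ be an entwining structure over a field $k$. For all $f\in C^m_{\psi-e}(A)$, $g\in C^n_{\psi-e}(A)$: $$f\diamond dg-d(f\diamond g)+(-1)^{n-1}df\diamond g=(-1)^{n-1}\left(g\cup f-(-1)^{mn}f\cup g\right).$$ Consequently the algebra $(H_{\psi-e}(A),\cup)$ is graded-commutative, i.e. $\xi\cup\eta=(-1)^{mn}\eta\cup\xi$ for $\xi\in H^m_{\psi-e}(A)$, $\eta\in H^n_{\psi-e}(A)$.
   Context: $k$ is a field, $\otimes=\otimes_k$; algebras are associative and unital, coalgebras are coassociative and counital; $\mathrm{Hom}$ means $k$-linear maps; $V^n=V^{\otimes n}$ (with $V^0=k$); $\Delta(c)=c_{(1)}\otimes c_{(2)}$ and $\epsilon$ are the coproduct and counit of $C$. An entwining structure $(A,C)_\psi$ consists of an algebra $A$, a coalgebra $C$ and a $k$-linear map $\psi:C\otimes A\to A\otimes C$, written $\psi(c\otimes a)=a_\alpha\otimes c^\alpha$ (summation understood; repeated application uses further Greek indices), such that for all $a,a'\in A$, $c\in C$: $(aa')_\alpha\otimes c^\alpha=a_\alpha a'_\beta\otimes c^{\alpha\beta}$; $1_\alpha\otimes c^\alpha=1\otimes c$; $a_\alpha\otimes (c^\alpha)_{(1)}\otimes (c^\alpha)_{(2)}=a_{\beta\alpha}\otimes c_{(1)}{}^\alpha\otimes c_{(2)}{}^\beta$; $a_\alpha\epsilon(c^\alpha)=a\epsilon(c)$. $C_\psi(A)$ is the cochain complex with $C^n_\psi(A)=\mathrm{Hom}(C\otimes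 A^n,A)$, $n\ge0$, and $$df(c,a^1,\ldots,a^{n+1})=a^1_\alpha f(c^\alpha,a^2,\ldots,a^{n+1})+\sum_{i=1}^n(-1)^if(c,a^1,\ldots,a^ia^{i+1},\ldots,a^{n+1})+(-1)^{n+1}f(c,a^1,\ldots,a^n)a^{n+1}.$$ For $f\in C^m_\psi(A)$, $g\in C^n_\psi(A)$ and $0\le i<m$ define $$(f\diamond_ig)(c,a^1,\ldots,a^{m+n-1})=f(c_{(1)},a^1_{\alpha_1},\ldots,a^i_{\alpha_i},g(c_{(2)}{}^{\alpha_1\ldots\alpha_i},a^{i+1},\ldots,a^{i+n}),a^{n+i+1},\ldots,a^{m+n-1}),$$ $f\diamond g=\sum_{i=0}^{m-1}(-1)^{i(n-1)}f\diamond_ig\in C_\psi^{m+n-1}(A)$ (zero if $m=0$), and $$(f\cup g)(c,a^1,\ldots,a^{m+n})=f(c_{(1)},a^1_{\alpha_1},\ldots,a^m_{\alpha_m})\,g(c_{(2)}{}^{\alpha_1\ldots\alpha_m},a^{m+1},\ldots,a^{m+n}).$$ $C^n_{\psi-e}(A)\subseteq C^n_\psi(A)$ is the subspace of those $f$ satisfying, for all $c\in C$, $a^1,\ldots,a^n\in A$, $$f(c_{(1)},a^1_{\alpha_1},\ldots,a^n_{\alpha_n})\otimes c_{(2)}{}^{\alpha_1\cdots\alpha_n}=f(c_{(2)},a^1,\ldots,a^n)_\alpha\otimes c_{(1)}{}^\alpha .$$ These subspaces are closed under all $\diamond_i$, under $\cup$ and under $d$, so $C_{\psi-e}(A)=(C^\bullet_{\psi-e}(A),d)$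 is a subcomplex of $C_\psi(A)$; its cohomology is $H_{\psi-e}(A)$ (the $\psi$-equivariant cohomology of $A$), and $\cup$ descends to it. *)

theory Defs
  imports Complex_Main "HOL-Library.Poly_Mapping" "HOL-Library.Function_Algebras" "HOL-Library.Set_Algebras"
begin

section \<open>Quotients and tensor products\<close>

text \<open>
  A vector space over a field \<open>'k\<close> is a type with a scalar multiplication satisfying
  \<^const>\<open>vector_space\<close>. Its quotient by a subspace \<open>N\<close> is the set of cosets \<open>x +o N\<close>;
  cosets are added by the Minkowski sum \<open>S + T\<close>.
\<close>

definition quot_space :: "'v::ab_group_add set \<Rightarrow> 'v set set" where
  "quot_space N = range (\<lambda>x. x +o N)"

definition quot_scale :: "('k \<Rightarrow> 'v \<Rightarrow> 'v) \<Rightarrow> 'v::ab_group_add set \<Rightarrow> 'k \<Rightarrow> 'v set \<Rightarrow> 'v set" where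
  "quot_scale s N r S = (\<Union>x\<in>S. s r x +o N)"

text \<open>The free vector space on \<open>'g\<close> is \<open>'g \<Rightarrow>\<^sub>0 'k\<close>.\<close>

definition free_scale :: "'k::field \<Rightarrow> ('g \<Rightarrow>\<^sub>0 'k) \<Rightarrow> ('g \<Rightarrow>\<^sub>0 'k)" where
  "free_scale r = Poly_Mapping.map (\<lambda>x. r * x)"

abbreviation gen :: "'g \<Rightarrow> ('g \<Rightarrow>\<^sub>0 'k::field)" where
  "gen p \<equiv> Poly_Mapping.single p 1"

text \<open>
  \<open>V \<otimes> W\<close> is the quotient of the free vector space on \<open>V \<times> W\<close> by the subspace generated by
  the bilinearity relations, and \<open>U \<otimes> V \<otimes> W\<close> is the quotient of the free vector space
  on \<open>U \<times> V \<times> W\<close> by the subspace generated by the trilinearity relations.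
\<close>

definition tensor_null ::
  "('k::field \<Rightarrow> 'v::ab_group_add \<Rightarrow> 'v) \<Rightarrow> ('k \<Rightarrow> 'w::ab_group_add \<Rightarrow> 'w) \<Rightarrow> ('v \<times> 'w \<Rightarrow>\<^sub>0 'k) set" where
  "tensor_null sV sW = module.span free_scale
    ({gen (v + v', w) - gen (v, w) - gen (v', w) | v v' w. True} \<union>
     {gen (v, w + w') - gen (v, w) - gen (v, w') | v w w'. True} \<union>
     {gen (sV r v, w) - free_scale r (gen (v, w)) | r v w. True} \<union>
     {gen (v, sW r w) - free_scale r (gen (v, w)) | r v w. True})"

definition tensor3_null ::
  "('k::field \<Rightarrow> 'u::ab_group_add \<Rightarrow> 'u) \<Rightarrow> ('k \<Rightarrow> 'v::ab_group_add \<Rightarrow> 'v) \<Rightarrow>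
   ('k \<Rightarrow> 'w::ab_group_add \<Rightarrow> 'w) \<Rightarrow> ('u \<times> 'v \<times> 'w \<Rightarrow>\<^sub>0 'k) set" where
  "tensor3_null sU sV sW = module.span free_scale
    ({gen (u + u', v, w) - gen (u, v, w) - gen (u', v, w) | u u' v w. True} \<union>
     {gen (u, v + v', w) - gen (u, v, w) - gen (u, v', w) | u v v' w. True} \<union>
     {gen (u, v, w + w') - gen (u, v, w) - gen (u, v, w') | u v w w'. True} \<union>
     {gen (sU r u, v, w) - free_scale r (gen (u, v, w)) | r u v w. True} \<union>
     {gen (u, sV r v, w) - free_scale r (gen (u, v, w)) | r u v w. True} \<union>
     {gen (u, v, sW r w) - free_scale r (gen (u, v, w)) | r u v w. True})"

definition pure_tensor ::
  "('k::field \<Rightarrow> 'v::ab_group_add \<Rightarrow> 'v) \<Rightarrow> ('k \<Rightarrow> 'w::ab_group_add \<Rightarrow> 'w) \<Rightarrow> 'v \<Rightarrow> 'w \<Rightarrow>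
   ('v \<times> 'w \<Rightarrow>\<^sub>0 'k) set" where
  "pure_tensor sV sW v w = gen (v, w) +o tensor_null sV sW"

text \<open>
  Sweedler sums. For a tensor \<open>t = \<Sum>\<^sub>j r\<^sub>j v\<^sub>j \<otimes> w\<^sub>j\<close> (a coset of formal sums),
  \<open>sweedler s B t\<close> is \<open>\<Sum>\<^sub>j r\<^sub>j B (v\<^sub>j, w\<^sub>j)\<close>, computed in a space with scalar multiplication \<open>s\<close>
  from some representing formal sum. It does not depend on the representative if \<open>B\<close> is bilinear.
  In tensor-valued sums, \<open>B\<close> takes values in a free vector space and is bilinear only modulo the
  null space; such sums are always followed by \<open>+o tensor_null _ _\<close> or \<open>+o tensor3_null _ _ _\<close>.
\<close>

definition sweedler ::
  "('k::field \<Rightarrow> 'x::ab_group_add \<Rightarrow> 'x) \<Rightarrow> ('g \<Rightarrow> 'x) \<Rightarrow> ('g \<Rightarrow>\<^sub>0 'k) set \<Rightarrow> 'x" where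
  "sweedler s B t =
    (let x = (SOME x. x \<in> t)
     in \<Sum>p\<in>Poly_Mapping.keys x. s (Poly_Mapping.lookup x p) (B p))"

section \<open>Entwining structures\<close>

text \<open>
  The sort \<open>{ring, monoid_mult}\<close> is that of unital associative rings; unlike \<open>ring_1\<close> it does not
  exclude the zero ring.
\<close>

record (overloaded) ('k, 'a, 'c) entw =
  scA :: "'k::field \<Rightarrow> 'a::{ring,monoid_mult} \<Rightarrow> 'a"
  scC :: "'k \<Rightarrow> 'c::ab_group_add \<Rightarrow> 'c"
  Delta :: "'c \<Rightarrow> ('c \<times> 'c \<Rightarrow>\<^sub>0 'k) set"
  eps :: "'c \<Rightarrow> 'k"
  psi :: "('c \<times> 'a \<Rightarrow>\<^sub>0 'k) set \<Rightarrow> ('a \<times> 'c \<Rightarrow>\<^sub>0 'k) set"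

definition is_algebra :: "('k::field \<Rightarrow> 'a::{ring,monoid_mult} \<Rightarrow> 'a) \<Rightarrow> bool" where
  "is_algebra s \<longleftrightarrow> vector_space s \<and>
    (\<forall>r x y. s r (x * y) = s r x * y) \<and> (\<forall>r x y. s r (x * y) = x * s r y)"

definition is_coalgebra ::
  "('k::field \<Rightarrow> 'c::ab_group_add \<Rightarrow> 'c) \<Rightarrow> ('c \<Rightarrow> ('c \<times> 'c \<Rightarrow>\<^sub>0 'k) set) \<Rightarrow> ('c \<Rightarrow> 'k) \<Rightarrow> bool" where
  "is_coalgebra s D e \<longleftrightarrow> vector_space s \<and>
    (\<forall>c. D c \<in> quot_space (tensor_null s s)) \<and>
    (\<forall>c c'. D (c + c') = D c + D c') \<and>
    (\<forall>r c. D (s r c) = quot_scale free_scale (tensor_null s s) r (D c)) \<and>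
    Vector_Spaces.linear s (*) e \<and>
    (\<forall>c. sweedler free_scale (\<lambda>(c1, c2).
             sweedler free_scale (\<lambda>(c11, c12). gen (c11, c12, c2)) (D c1)) (D c) +o tensor3_null s s s
       = sweedler free_scale (\<lambda>(c1, c2).
             sweedler free_scale (\<lambda>(c21, c22). gen (c1, c21, c22)) (D c2)) (D c) +o tensor3_null s s s) \<and>
    (\<forall>c. sweedler s (\<lambda>(c1, c2). s (e c1) c2) (D c) = c) \<and>
    (\<forall>c. sweedler s (\<lambda>(c1, c2). s (e c2) c1) (D c) = c)"

abbreviation AC_null :: "('k::field, 'a::{ring,monoid_mult}, 'c::ab_group_add) entw \<Rightarrow> ('a \<times> 'c \<Rightarrow>\<^sub>0 'k) set" where
  "AC_null E \<equiv> tensor_null (scA E) (scC E)"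

abbreviation CA_null :: "('k::field, 'a::{ring,monoid_mult}, 'c::ab_group_add) entw \<Rightarrow> ('c \<times> 'a \<Rightarrow>\<^sub>0 'k) set" where
  "CA_null E \<equiv> tensor_null (scC E) (scA E)"

abbreviation ACC_null :: "('k::field, 'a::{ring,monoid_mult}, 'c::ab_group_add) entw \<Rightarrow> ('a \<times> 'c \<times> 'c \<Rightarrow>\<^sub>0 'k) set" where
  "ACC_null E \<equiv> tensor3_null (scA E) (scC E) (scC E)"

definition ent :: "('k::field, 'a::{ring,monoid_mult}, 'c::ab_group_add) entw \<Rightarrow> 'c \<Rightarrow> 'a \<Rightarrow> ('a \<times> 'c \<Rightarrow>\<^sub>0 'k) set" where
  "ent E c a = psi E (pure_tensor (scC E) (scA E) c a)"

definition entwining_structure :: "('k::field, 'a::{ring,monoid_mult}, 'c::ab_group_add) entw \<Rightarrow> bool" where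
  "entwining_structure E \<longleftrightarrow>
    is_algebra (scA E) \<and> is_coalgebra (scC E) (Delta E) (eps E) \<and>
    \<comment> \<open>\<open>\<psi> : C \<otimes> A \<rightarrow> A \<otimes> C\<close> is a linear map\<close>
    (\<forall>t \<in> quot_space (CA_null E). psi E t \<in> quot_space (AC_null E)) \<and>
    (\<forall>t \<in> quot_space (CA_null E). \<forall>t' \<in> quot_space (CA_null E). psi E (t + t') = psi E t + psi E t') \<and>
    (\<forall>r. \<forall>t \<in> quot_space (CA_null E).
       psi E (quot_scale free_scale (CA_null E) r t) = quot_scale free_scale (AC_null E) r (psi E t)) \<and>
    \<comment> \<open>\<open>(aa')\<^sub>\<alpha> \<otimes> c\<^sup>\<alpha> = a\<^sub>\<alpha> a'\<^sub>\<beta> \<otimes> c\<^sup>\<alpha>\<^sup>\<beta>\<close>\<close>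
    (\<forall>c a a'. ent E c (a * a') =
       sweedler free_scale (\<lambda>(x, c').
         sweedler free_scale (\<lambda>(y, c''). gen (x * y, c'')) (ent E c' a')) (ent E c a) +o AC_null E) \<and>
    \<comment> \<open>\<open>1\<^sub>\<alpha> \<otimes> c\<^sup>\<alpha> = 1 \<otimes> c\<close>\<close>
    (\<forall>c. ent E c 1 = pure_tensor (scA E) (scC E) 1 c) \<and>
    \<comment> \<open>\<open>a\<^sub>\<alpha> \<otimes> (c\<^sup>\<alpha>)\<^sub>(\<^sub>1\<^sub>) \<otimes> (c\<^sup>\<alpha>)\<^sub>(\<^sub>2\<^sub>) = a\<^sub>\<beta>\<^sub>\<alpha> \<otimes> c\<^sub>(\<^sub>1\<^sub>)\<^sup>\<alpha> \<otimes> c\<^sub>(\<^sub>2\<^sub>)\<^sup>\<beta>\<close>\<close>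
    (\<forall>c a.
       sweedler free_scale (\<lambda>(x, c').
         sweedler free_scale (\<lambda>(c1, c2). gen (x, c1, c2)) (Delta E c')) (ent E c a) +o ACC_null E
     = sweedler free_scale (\<lambda>(c1, c2).
         sweedler free_scale (\<lambda>(x, c2').
           sweedler free_scale (\<lambda>(y, c1'). gen (y, c1', c2')) (ent E c1 x)) (ent E c2 a)) (Delta E c)
         +o ACC_null E) \<and>
    \<comment> \<open>\<open>a\<^sub>\<alpha> \<epsilon>(c\<^sup>\<alpha>) = a \<epsilon>(c)\<close>\<close>
    (\<forall>c a. sweedler (scA E) (\<lambda>(x, c'). scA E (eps E c') x) (ent E c a) = scA E (eps E c) a)"

section \<open>The complex of an entwining structure\<close>

text \<open>
  A linear map \<open>C \<otimes> A\<^sup>n \<rightarrow> A\<close> is given as a multilinear map \<open>f c [a\<^sup>1, \<dots>, a\<^sup>n]\<close>, extended by \<open>0\<close> to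
  lists of other lengths, so that equality of cochains is equality of functions.
\<close>

type_synonym ('a, 'c) cochain = "'c \<Rightarrow> 'a list \<Rightarrow> 'a"

definition cochains :: "('k::field, 'a::{ring,monoid_mult}, 'c::ab_group_add) entw \<Rightarrow> nat \<Rightarrow> ('a, 'c) cochain set" where
  "cochains E n = {f.
    (\<forall>c as. length as \<noteq> n \<longrightarrow> f c as = 0) \<and>
    (\<forall>as. length as = n \<longrightarrow> Vector_Spaces.linear (scC E) (scA E) (\<lambda>c. f c as)) \<and>
    (\<forall>c as bs. length as + 1 + length bs = n \<longrightarrow>
       Vector_Spaces.linear (scA E) (scA E) (\<lambda>a. f c (as @ a # bs)))}"

definition scale_cochain :: "('k::field, 'a::{ring,monoid_mult}, 'c::ab_group_add) entw \<Rightarrow> 'k \<Rightarrow>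
    ('a, 'c) cochain \<Rightarrow> ('a, 'c) cochain" where
  "scale_cochain E r f = (\<lambda>c as. scA E r (f c as))"

text \<open>\<open>pass E s F c [a\<^sup>1, \<dots>, a\<^sup>i]\<close> is the sum of \<open>F [a\<^sup>1\<^sub>\<alpha>\<^sub>1, \<dots>, a\<^sup>i\<^sub>\<alpha>\<^sub>i] c\<^sup>\<alpha>\<^sup>1\<^sup>\<dots>\<^sup>\<alpha>\<^sup>i\<close>.\<close>

primrec pass :: "('k::field, 'a::{ring,monoid_mult}, 'c::ab_group_add) entw \<Rightarrow>
    ('k \<Rightarrow> 'x::ab_group_add \<Rightarrow> 'x) \<Rightarrow> ('a list \<Rightarrow> 'c \<Rightarrow> 'x) \<Rightarrow> 'c \<Rightarrow> 'a list \<Rightarrow> 'x" where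
  "pass E s F c [] = F [] c"
| "pass E s F c (a # as) =
     sweedler s (\<lambda>(x, c'). pass E s (\<lambda>bs. F (x # bs)) c' as) (ent E c a)"

text \<open>
  The degrees are explicit arguments. List positions count from \<open>0\<close>: the \<open>i\<close>-th inner summand
  of the differential replaces \<open>as ! (i - 1) = a\<^sup>i\<close> and \<open>as ! i = a\<^sup>i\<^sup>+\<^sup>1\<close> by their product.
\<close>

definition differential :: "('k::field, 'a::{ring,monoid_mult}, 'c::ab_group_add) entw \<Rightarrow> nat \<Rightarrow>
    ('a, 'c) cochain \<Rightarrow> ('a, 'c) cochain" where
  "differential E n f = (\<lambda>c as. if length as \<noteq> n + 1 then 0 else
     sweedler (scA E) (\<lambda>(x, c'). x * f c' (tl as)) (ent E c (hd as))
     + (\<Sum>i = 1..n. scA E ((-1) ^ i) (f c (take (i - 1) as @ (as ! (i - 1) * as ! i) # drop (i + 1) as)))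
     + scA E ((-1) ^ (n + 1)) (f c (butlast as) * last as))"

definition diamond_at :: "('k::field, 'a::{ring,monoid_mult}, 'c::ab_group_add) entw \<Rightarrow> nat \<Rightarrow> nat \<Rightarrow> nat \<Rightarrow>
    ('a, 'c) cochain \<Rightarrow> ('a, 'c) cochain \<Rightarrow> ('a, 'c) cochain" where
  "diamond_at E m n i f g = (\<lambda>c as. if length as \<noteq> m + n - 1 then 0 else
     sweedler (scA E) (\<lambda>(c1, c2).
       pass E (scA E) (\<lambda>bs c'. f c1 (bs @ g c' (take n (drop i as)) # drop (i + n) as)) c2 (take i as))
     (Delta E c))"

definition diamond :: "('k::field, 'a::{ring,monoid_mult}, 'c::ab_group_add) entw \<Rightarrow> nat \<Rightarrow> nat \<Rightarrow>
    ('a, 'c) cochain \<Rightarrow> ('a, 'c) cochain \<Rightarrow> ('a, 'c) cochain" where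
  "diamond E m n f g =
     (\<Sum>i<m. scale_cochain E ((-1) powi (int i * (int n - 1))) (diamond_at E m n i f g))"

definition cup :: "('k::field, 'a::{ring,monoid_mult}, 'c::ab_group_add) entw \<Rightarrow> nat \<Rightarrow> nat \<Rightarrow>
    ('a, 'c) cochain \<Rightarrow> ('a, 'c) cochain \<Rightarrow> ('a, 'c) cochain" where
  "cup E m n f g = (\<lambda>c as. if length as \<noteq> m + n then 0 else
     sweedler (scA E) (\<lambda>(c1, c2).
       pass E (scA E) (\<lambda>bs c'. f c1 bs * g c' (drop m as)) c2 (take m as))
     (Delta E c))"

section \<open>Equivariant cochains and their cohomology\<close>

definition equivariant_cochains :: "('k::field, 'a::{ring,monoid_mult}, 'c::ab_group_add) entw \<Rightarrow> nat \<Rightarrow>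
    ('a, 'c) cochain set" where
  "equivariant_cochains E n = {f \<in> cochains E n. \<forall>c as. length as = n \<longrightarrow>
     sweedler free_scale (\<lambda>(c1, c2).
       pass E free_scale (\<lambda>bs c'. gen (f c1 bs, c')) c2 as) (Delta E c) +o AC_null E
   = sweedler free_scale (\<lambda>(c1, c2).
       sweedler free_scale (\<lambda>(x, c'). gen (x, c')) (ent E c1 (f c2 as))) (Delta E c) +o AC_null E}"

definition cocycles :: "('k::field, 'a::{ring,monoid_mult}, 'c::ab_group_add) entw \<Rightarrow> nat \<Rightarrow>
    ('a, 'c) cochain set" where
  "cocycles E n = {f \<in> equivariant_cochains E n. differential E n f = 0}"

definition coboundaries :: "('k::field, 'a::{ring,monoid_mult}, 'c::ab_group_add) entw \<Rightarrow> nat \<Rightarrow>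
    ('a, 'c) cochain set" where
  "coboundaries E n = (case n of 0 \<Rightarrow> {0} | Suc k \<Rightarrow> differential E k ` equivariant_cochains E k)"

definition cohomology :: "('k::field, 'a::{ring,monoid_mult}, 'c::ab_group_add) entw \<Rightarrow> nat \<Rightarrow>
    ('a, 'c) cochain set set" where
  "cohomology E n = (\<lambda>f. f +o coboundaries E n) ` cocycles E n"

definition cohomology_scale :: "('k::field, 'a::{ring,monoid_mult}, 'c::ab_group_add) entw \<Rightarrow> nat \<Rightarrow>
    'k \<Rightarrow> ('a, 'c) cochain set \<Rightarrow> ('a, 'c) cochain set" where
  "cohomology_scale E n = quot_scale (scale_cochain E) (coboundaries E n)"

definition cohomology_cup :: "('k::field, 'a::{ring,monoid_mult}, 'c::ab_group_add) entw \<Rightarrow> nat \<Rightarrow> nat \<Rightarrow>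
    ('a, 'c) cochain set \<Rightarrow> ('a, 'c) cochain set \<Rightarrow> ('a, 'c) cochain set" where
  "cohomology_cup E m n \<xi> \<eta> = (\<Union>f\<in>\<xi>. \<Union>g\<in>\<eta>. cup E m n f g +o coboundaries E (m + n))"

end

theory Submission
  imports Defs
begin

text \<open>
  The compositions \<open>\<diamond>\<^sub>i\<close> make the equivariant cochains a nonsymmetric operad: nested composition is
  associative by coassociativity and the compatibility of \<open>\<psi>\<close> with \<open>\<Delta>\<close>, and equivariance is what
  allows two insertions in different arguments to be interchanged. The cochain
  \<open>\<mu>(c, a, b) = \<epsilon>(c) a b\<close> is an associative multiplication in this operad, the differential is
  \<open>d f = (-1)\<^sup>n\<^sup>+\<^sup>1 \<mu> \<diamond> f - f \<diamond> \<mu>\<close>, and \<open>f \<union> g = (\<mu> \<diamond>\<^sub>0 f) \<diamond>\<^sub>m g\<close>. Gerstenhaber's argument then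
  applies: the associator \<open>(f \<diamond> g) \<diamond> h - f \<diamond> (g \<diamond> h)\<close> is graded symmetric in \<open>g\<close> and \<open>h\<close>, and
  for \<open>\<mu>\<close>, \<open>f\<close>, \<open>g\<close> it consists of the two cup products.
\<close>

section \<open>Tensors as formal sums\<close>

text \<open>Two obstacles shape the proof. Tensors are cosets and a Sweedler sum picks a
  representative, so tensor-valued identities are awkward to compute with. They are therefore
  evaluated on multilinear maps: the linear extension of such a map kills the relations. Conversely,
  linear functionals separate a vector from a subspace, so bilinear maps A \<times> C \<rightarrow>
  k suffice to prove equivariance. The second obstacle is the interchange of insertions. If h is
  inserted to the left of g, then in one order the value of h is twisted by the coefficient on its
  way to g, in the other order the arguments of h are twisted by it. Equivariance of h says that
  these agree. That composites are again equivariant needs the same exchange, with the coefficient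
  going to a test map instead of to g; hence one general lemma about a function of the arguments and
  a final coefficient serves both. The operadic part works in abelian groups with signs and never
  divides by two, so the characteristic of k is arbitrary.\<close>

abbreviation linear :: "('k::field \<Rightarrow> 'v::ab_group_add \<Rightarrow> 'v) \<Rightarrow> ('k \<Rightarrow> 'w::ab_group_add \<Rightarrow> 'w) \<Rightarrow> ('v \<Rightarrow> 'w) \<Rightarrow> bool"
  where "linear \<equiv> Vector_Spaces.linear"

lemmas linear_iff = Vector_Spaces.linear_iff

section \<open>Linear extension from a free vector space\<close>

lemma lookup_free_scale [simp]: "Poly_Mapping.lookup (free_scale r x) p = r * Poly_Mapping.lookup x p"
  by (simp add: free_scale_def Poly_Mapping.map.rep_eq when_def)

lemma vector_space_free_scale: "vector_space free_scale"
  by standard (auto intro!: poly_mapping_eqI simp: lookup_add algebra_simps)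

lemma free_scale_add: "free_scale r (x + y) = free_scale r x + free_scale r y"
  by (rule poly_mapping_eqI) (simp add: lookup_add algebra_simps)

lemma vector_space_mult: "vector_space ((*) :: 'k::field \<Rightarrow> 'k \<Rightarrow> 'k)"
  by standard (auto simp: algebra_simps)

text \<open>This is the sum inside \<open>sweedler\<close> with the choice of a representative split
  off: the linear extension of \<open>B\<close> from the basis.\<close>

definition free_lift ::
  "('k::field \<Rightarrow> 'x::ab_group_add \<Rightarrow> 'x) \<Rightarrow> ('g \<Rightarrow> 'x) \<Rightarrow> ('g \<Rightarrow>\<^sub>0 'k) \<Rightarrow> 'x" where
  "free_lift s B x = (\<Sum>p\<in>Poly_Mapping.keys x. s (Poly_Mapping.lookup x p) (B p))"

lemma sweedler_conv_free_lift: "sweedler s B t = free_lift s B (SOME x. x \<in> t)"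
  by (simp add: sweedler_def free_lift_def Let_def)

context vector_space
begin

lemma free_lift_superset:
  assumes "finite S" "Poly_Mapping.keys x \<subseteq> S"
  shows "free_lift scale B x = (\<Sum>p\<in>S. scale (Poly_Mapping.lookup x p) (B p))"
  unfolding free_lift_def
  by (rule sum.mono_neutral_left) (use assms in \<open>auto simp: in_keys_iff\<close>)

lemma linear_free_lift: "linear free_scale scale (free_lift scale B)"
proof -
  have "free_lift scale B (x + y) = free_lift scale B x + free_lift scale B y" for x y
  proof -
    let ?S = "Poly_Mapping.keys x \<union> Poly_Mapping.keys y"
    have "Poly_Mapping.keys (x + y) \<subseteq> ?S" by (rule keys_add)
    then show ?thesis
      by (simp add: free_lift_superset[of ?S] lookup_add scale_left_distrib sum.distrib)
  qed
  moreover have "free_lift scale B (free_scale r x) = scale r (free_lift scale B x)" for r x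
  proof -
    have "Poly_Mapping.keys (free_scale r x) \<subseteq> Poly_Mapping.keys x"
      by (auto simp: in_keys_iff)
    then show ?thesis
      by (simp add: free_lift_superset[of "Poly_Mapping.keys x"] scale_sum_right)
  qed
  ultimately show ?thesis
    by (simp add: linear_iff vector_space_free_scale vector_space_axioms)
qed

lemma free_lift_gen [simp]: "free_lift scale B (gen p) = B p"
  by (simp add: free_lift_def)

lemma free_lift_add: "free_lift scale B (x + y) = free_lift scale B x + free_lift scale B y"
  and free_lift_diff: "free_lift scale B (x - y) = free_lift scale B x - free_lift scale B y"
  and free_lift_free_scale: "free_lift scale B (free_scale r x) = scale r (free_lift scale B x)"
proof -
  interpret h: module_hom free_scale scale "free_lift scale B"
    using linear_free_lift by (simp add: module_hom_iff_linear)
  show "free_lift scale B (x + y) = free_lift scale B x + free_lift scale B y"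
    and "free_lift scale B (x - y) = free_lift scale B x - free_lift scale B y"
    and "free_lift scale B (free_scale r x) = scale r (free_lift scale B x)"
    by (fact h.add h.diff h.scale)+
qed

lemma free_lift_span_eq_0:
  assumes "\<And>x. x \<in> S \<Longrightarrow> free_lift scale B x = 0" and "x \<in> module.span free_scale S"
  shows "free_lift scale B x = 0"
proof -
  interpret h: module_hom free_scale scale "free_lift scale B"
    using linear_free_lift by (simp add: module_hom_iff_linear)
  show ?thesis using h.eq_0_on_span assms by blast
qed

text \<open>The universal property of the tensor product: on each generating relation, the value of
  the linear extension is an instance of the additivity or homogeneity of \<open>B\<close>.\<close>

lemma free_lift_tensor_null:
  assumes "\<And>y. linear s1 scale (\<lambda>x. B (x, y))" "\<And>x. linear s2 scale (\<lambda>y. B (x, y))"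
    and "x \<in> tensor_null s1 s2"
  shows "free_lift scale B x = 0"
  using assms(3) unfolding tensor_null_def
  by (rule free_lift_span_eq_0[rotated])
    (use assms(1,2) in \<open>auto simp: free_lift_diff free_lift_free_scale linear_iff\<close>)

lemma free_lift_tensor3_null:
  assumes "\<And>y z. linear s1 scale (\<lambda>x. B (x, y, z))" "\<And>x z. linear s2 scale (\<lambda>y. B (x, y, z))"
    "\<And>x y. linear s3 scale (\<lambda>z. B (x, y, z))" and "x \<in> tensor3_null s1 s2 s3"
  shows "free_lift scale B x = 0"
  using assms(4) unfolding tensor3_null_def
  by (rule free_lift_span_eq_0[rotated])
    (use assms(1-3) in \<open>auto simp: free_lift_diff free_lift_free_scale linear_iff\<close>)

end

section \<open>Cosets of subspaces\<close>

lemma span_free_zero: "0 \<in> module.span free_scale S"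
  and span_free_add: "x \<in> module.span free_scale S \<Longrightarrow> y \<in> module.span free_scale S \<Longrightarrow> x + y \<in> module.span free_scale S"
  and span_free_diff: "x \<in> module.span free_scale S \<Longrightarrow> y \<in> module.span free_scale S \<Longrightarrow> x - y \<in> module.span free_scale S"
  and span_free_scale: "x \<in> module.span free_scale S \<Longrightarrow> free_scale r x \<in> module.span free_scale S"
  and span_free_base: "x \<in> S \<Longrightarrow> x \<in> module.span free_scale S"
proof -
  interpret vector_space free_scale by (rule vector_space_free_scale)
  show "0 \<in> module.span free_scale S" by (rule span_zero)
  show "x \<in> module.span free_scale S \<Longrightarrow> y \<in> module.span free_scale S \<Longrightarrow> x + y \<in> module.span free_scale S"
    by (rule span_add)
  show "x \<in> module.span free_scale S \<Longrightarrow> y \<in> module.span free_scale S \<Longrightarrow> x - y \<in> module.span free_scale S"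
    by (rule span_diff)
  show "x \<in> module.span free_scale S \<Longrightarrow> free_scale r x \<in> module.span free_scale S"
    by (rule span_scale)
  show "x \<in> S \<Longrightarrow> x \<in> module.span free_scale S" by (rule span_base)
qed

text \<open>The setting is an arbitrary subgroup because the lemma serves both the null spaces of
  tensor products and the coboundaries.\<close>

lemma coset_eq_iff:
  fixes N :: "'v::ab_group_add set"
  assumes zero: "0 \<in> N" and diff: "\<And>x y. x \<in> N \<Longrightarrow> y \<in> N \<Longrightarrow> x - y \<in> N"
  shows "x +o N = y +o N \<longleftrightarrow> x - y \<in> N"
proof
  assume "x +o N = y +o N"
  moreover have "x \<in> x +o N" using set_plus_intro2[of 0 N x] zero by simp
  ultimately show "x - y \<in> N" by (simp add: set_minus_plus)
next
  have sub: "x +o N \<subseteq> y +o N" if *: "x - y \<in> N" for x y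
  proof
    fix z assume "z \<in> x +o N"
    then obtain l where l: "l \<in> N" "z = x + l" by (auto simp: elt_set_plus_def)
    have "z = y + (l - (0 - (x - y)))" by (simp add: l)
    moreover have "l - (0 - (x - y)) \<in> N" by (intro diff l zero *)
    ultimately show "z \<in> y +o N" unfolding elt_set_plus_def by blast
  qed
  assume "x - y \<in> N"
  moreover from diff[OF zero this] have "y - x \<in> N" by simp
  ultimately show "x +o N = y +o N" using sub by blast
qed

lemma span_coset_eq_iff:
  assumes N: "N = module.span free_scale S"
  shows "x +o N = y +o N \<longleftrightarrow> x - y \<in> N"
  unfolding N by (intro coset_eq_iff span_free_zero span_free_diff)

lemma coset_add_coset:
  assumes N: "N = module.span free_scale S"
  shows "(x +o N) + (y +o N) = (x + y) +o N"
proof -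
  have "N + N = N"
  proof
    show "N + N \<subseteq> N" using span_free_add[of _ S] by (auto simp: N set_plus_def)
    show "N \<subseteq> N + N" using set_zero_plus2[of N N] span_free_zero[of S] by (simp add: N)
  qed
  then show ?thesis by (simp add: set_plus_rearrange)
qed

text \<open>All representatives contribute the same coset to the union that defines
  \<open>quot_scale\<close>, and the union is not empty.\<close>

lemma quot_scale_coset:
  assumes N: "N = module.span free_scale S"
  shows "quot_scale free_scale N r (x +o N) = free_scale r x +o N"
proof -
  have "free_scale r z +o N = free_scale r x +o N" if "z \<in> x +o N" for z
    using that span_free_scale[of "z - x" S r]
    by (subst span_coset_eq_iff[OF N])
      (auto simp: N elt_set_plus_def free_scale_add)
  moreover have "x \<in> x +o N"
    using set_plus_intro2[of 0 N x] by (simp add: N span_free_zero)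
  ultimately show ?thesis
    unfolding quot_scale_def by blast
qed

text \<open>Linear functionals detect membership in a subspace. This turns an equation in A
  \<otimes> C into equations between values of bilinear forms.\<close>

lemma span_free_separate:
  fixes x y :: "'g \<Rightarrow>\<^sub>0 'k::field"
  assumes "\<And>\<phi>. linear free_scale (*) \<phi> \<Longrightarrow> (\<And>z. z \<in> S \<Longrightarrow> \<phi> z = 0) \<Longrightarrow> \<phi> x = \<phi> y"
  shows "x - y \<in> module.span free_scale S"
proof (rule ccontr)
  assume x: "x - y \<notin> module.span free_scale S"
  interpret vector_space_pair free_scale "(*) :: 'k \<Rightarrow> 'k \<Rightarrow> 'k"
    by (simp add: vector_space_pair_def vector_space_free_scale vector_space_mult)
  \<comment> \<open>Passing to an independent set with the same span as \<open>S\<close> makes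
    \<open>insert (x - y) B\<close> independent, so a functional may be prescribed as 1 at
    \<open>x - y\<close> and 0 on \<open>B\<close>.\<close>
  obtain B where B: "B \<subseteq> S" "vs1.independent B" "S \<subseteq> vs1.span B"
    using vs1.maximal_independent_subset[of S] by blast
  then have sp: "vs1.span B = vs1.span S"
    by (simp add: subset_antisym vs1.span_minimal vs1.span_mono)
  then have "vs1.independent (insert (x - y) B)"
    using vs1.independent_insertI[of "x - y" B] x B(2) by simp
  then obtain \<phi> where \<phi>: "Vector_Spaces.linear free_scale (*) \<phi>"
      "\<forall>z\<in>insert (x - y) B. \<phi> z = (if z = x - y then 1 else 0)"
    using linear_independent_extend[of "insert (x - y) B" "\<lambda>z. if z = x - y then 1 else 0"] by blast
  interpret l: module_hom free_scale "(*)" \<phi>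
    using \<phi>(1) by (simp add: module_hom_iff_linear)
  have "\<phi> b = 0" if "b \<in> B" for b
    using that \<phi>(2) x vs1.span_base sp by auto
  then have "\<phi> z = 0" if "z \<in> S" for z
    using that l.eq_0_on_span B(3) by blast
  then have "\<phi> x = \<phi> y" using assms \<phi>(1) by blast
  moreover have "\<phi> (x - y) = 1" using \<phi>(2) by simp
  ultimately show False by (simp add: l.diff)
qed

lemma some_coset:
  assumes "N = module.span free_scale S"
  obtains n where "n \<in> N" "(SOME z. z \<in> x +o N) = x + n"
proof -
  have "x \<in> x +o N"
    using set_plus_intro2[of 0 N x] assms by (simp add: span_free_zero)
  then have "(SOME z. z \<in> x +o N) \<in> x +o N" by (rule someI)
  then show thesis using that by (auto simp: elt_set_plus_def)
qed

text \<open>The chosen representative differs from \<open>x\<close> by an element of the null space,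
  which contributes 0 since \<open>B\<close> is bilinear.\<close>

lemma (in vector_space) sweedler_coset:
  assumes "\<And>y. linear s1 scale (\<lambda>x. B (x, y))" "\<And>x. linear s2 scale (\<lambda>y. B (x, y))"
  shows "sweedler scale B (x +o tensor_null s1 s2) = free_lift scale B x"
proof -
  obtain n where "n \<in> tensor_null s1 s2" "(SOME z. z \<in> x +o tensor_null s1 s2) = x + n"
    using some_coset[OF tensor_null_def] .
  then show ?thesis
    using free_lift_tensor_null[of s1 B s2 n] assms
    by (simp add: sweedler_conv_free_lift free_lift_add)
qed

lemma linear_free_lift_comp:
  assumes "linear s s' L"
  shows "L (free_lift s B x) = free_lift s' (\<lambda>p. L (B p)) x"
proof -
  interpret module_hom s s' L using assms by (simp add: module_hom_iff_linear)
  show ?thesis by (simp add: free_lift_def sum scale)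
qed

lemma linear_sweedler_comp:
  "linear s s' L \<Longrightarrow> L (sweedler s B t) = sweedler s' (\<lambda>p. L (B p)) t"
  by (simp add: sweedler_conv_free_lift linear_free_lift_comp)

lemma (in vector_space) sweedler_commute:
  "sweedler scale (\<lambda>p. sweedler scale (\<lambda>q. B p q) t') t = sweedler scale (\<lambda>q. sweedler scale (\<lambda>p. B p q) t) t'"
  unfolding sweedler_def Let_def scale_sum_right
  by (subst sum.swap) (simp add: mult.commute)

lemma linear_sweedler:
  assumes "vector_space s'" "vector_space s" "\<And>p. linear s' s (\<lambda>v. B v p)"
  shows "linear s' s (\<lambda>v. sweedler s (B v) t)"
proof -
  interpret vector_space s by fact
  show ?thesis
    using assms(1,3)
    by (auto simp: linear_iff sweedler_def Let_def scale_right_distrib sum.distrib scale_sum_right mult.commute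
        vector_space_axioms)
qed

section \<open>Sweedler calculus\<close>

lemma linear_comp: "linear s1 s2 g \<Longrightarrow> linear s2 s3 f \<Longrightarrow> linear s1 s3 (\<lambda>v. f (g v))"
  by (simp add: linear_iff)

locale entwining =
  fixes E :: "('k::field, 'a::{ring,monoid_mult}, 'c::ab_group_add) entw"
  assumes entwining: "entwining_structure E"
begin

abbreviation "sA \<equiv> scA E"
abbreviation "sC \<equiv> scC E"

lemma algebra: "is_algebra sA" and coalgebra: "is_coalgebra sC (Delta E) (eps E)"
  using entwining by (auto simp: entwining_structure_def)

lemma vector_space_A: "vector_space sA" and vector_space_C: "vector_space sC"
  using algebra coalgebra by (auto simp: is_algebra_def is_coalgebra_def)

lemma scale_mult_left: "sA r x * y = sA r (x * y)" and scale_mult_right: "x * sA r y = sA r (x * y)"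
  using algebra by (auto simp: is_algebra_def)

lemma linear_eps: "linear sC (*) (eps E)"
  using coalgebra by (auto simp: is_coalgebra_def)

lemma Delta_coset: obtains x where "Delta E c = x +o tensor_null sC sC"
proof -
  have "Delta E c \<in> quot_space (tensor_null sC sC)"
    using coalgebra by (simp add: is_coalgebra_def)
  then show thesis using that by (auto simp: quot_space_def)
qed

lemma Delta_add: "Delta E (c + c') = Delta E c + Delta E c'"
  using coalgebra by (simp add: is_coalgebra_def)

lemma Delta_scale: "Delta E (sC r c) = quot_scale free_scale (tensor_null sC sC) r (Delta E c)"
  using coalgebra by (simp add: is_coalgebra_def)

lemma pure_tensor_in_quot_space: "pure_tensor sC sA c a \<in> quot_space (CA_null E)"
  by (auto simp: pure_tensor_def quot_space_def)

lemma ent_coset: obtains x where "ent E c a = x +o AC_null E"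
  using entwining pure_tensor_in_quot_space[of c a]
  by (fastforce simp: entwining_structure_def quot_space_def ent_def)

lemma pure_tensor_add_left:
    "pure_tensor sC sA (c + c') a = pure_tensor sC sA c a + pure_tensor sC sA c' a"
  and pure_tensor_add_right:
    "pure_tensor sC sA c (a + a') = pure_tensor sC sA c a + pure_tensor sC sA c a'"
  and pure_tensor_scale_left:
    "pure_tensor sC sA (sC r c) a = quot_scale free_scale (CA_null E) r (pure_tensor sC sA c a)"
  and pure_tensor_scale_right:
    "pure_tensor sC sA c (sA r a) = quot_scale free_scale (CA_null E) r (pure_tensor sC sA c a)"
proof -
  note * = coset_add_coset[OF tensor_null_def] span_coset_eq_iff[OF tensor_null_def]
    quot_scale_coset[OF tensor_null_def]
  show "pure_tensor sC sA (c + c') a = pure_tensor sC sA c a + pure_tensor sC sA c' a"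
    unfolding pure_tensor_def * unfolding tensor_null_def
    \<comment> \<open>The difference of cosets is brought into the form \<open>x - y - z\<close>, in
      which the relation occurs among the generators of \<open>tensor_null\<close>.\<close>
    unfolding diff_diff_eq[symmetric] by (rule span_free_base) blast
  show "pure_tensor sC sA c (a + a') = pure_tensor sC sA c a + pure_tensor sC sA c a'"
    unfolding pure_tensor_def * unfolding tensor_null_def
    unfolding diff_diff_eq[symmetric] by (rule span_free_base) blast
  show "pure_tensor sC sA (sC r c) a = quot_scale free_scale (CA_null E) r (pure_tensor sC sA c a)"
    unfolding pure_tensor_def * unfolding tensor_null_def by (rule span_free_base) blast
  show "pure_tensor sC sA c (sA r a) = quot_scale free_scale (CA_null E) r (pure_tensor sC sA c a)"
    unfolding pure_tensor_def * unfolding tensor_null_def by (rule span_free_base) blast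
qed

lemma ent_add_left: "ent E (c + c') a = ent E c a + ent E c' a"
  and ent_add_right: "ent E c (a + a') = ent E c a + ent E c a'"
  and ent_scale_left: "ent E (sC r c) a = quot_scale free_scale (AC_null E) r (ent E c a)"
  and ent_scale_right: "ent E c (sA r a) = quot_scale free_scale (AC_null E) r (ent E c a)"
  using entwining pure_tensor_in_quot_space
  by (simp_all add: entwining_structure_def ent_def pure_tensor_add_left pure_tensor_add_right
      pure_tensor_scale_left pure_tensor_scale_right)

end

text \<open>Three targets occur: A for cochains and their compositions, the free vector space on A
  \<times> C for the equation defining equivariance, and the field for testing that
  equation.\<close>

locale entwining_target = entwining E + vector_space s
  for E :: "('k::field, 'a::{ring,monoid_mult}, 'c::ab_group_add) entw"
    and s :: "'k \<Rightarrow> 'x::ab_group_add \<Rightarrow> 'x"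
begin

text \<open>
  Sweedler notation in continuation-passing style: \<open>copr B c\<close> is \<open>B(c\<^sub>(\<^sub>1\<^sub>), c\<^sub>(\<^sub>2\<^sub>))\<close> and
  \<open>twist B c a\<close> is \<open>B(a\<^sub>\<alpha>, c\<^sup>\<alpha>)\<close>. Both are finite sums over a fixed representative, so they
  commute with each other and with linear maps for arbitrary \<open>B\<close>; multilinearity only matters for
  the axioms of an entwining structure.
\<close>

definition copr :: "('c \<Rightarrow> 'c \<Rightarrow> 'x) \<Rightarrow> 'c \<Rightarrow> 'x" where
  "copr B c = sweedler s (\<lambda>(x, y). B x y) (Delta E c)"

definition twist :: "('a \<Rightarrow> 'c \<Rightarrow> 'x) \<Rightarrow> 'c \<Rightarrow> 'a \<Rightarrow> 'x" where
  "twist B c a = sweedler s (\<lambda>(x, y). B x y) (ent E c a)"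

text \<open>There is no condition on lengths: a cochain vanishes on lists of the wrong length, where
  linearity holds trivially.\<close>

definition multilinear :: "('a list \<Rightarrow> 'x) \<Rightarrow> bool" where
  "multilinear F \<longleftrightarrow> (\<forall>xs ys. linear sA s (\<lambda>a. F (xs @ a # ys)))"

lemma pass_Cons: "pass E s F c (a # as) = twist (\<lambda>x c'. pass E s (\<lambda>bs. F (x # bs)) c' as) c a"
  by (simp add: twist_def)

section \<open>Linearity of Sweedler sums\<close>

lemma linear_copr:
  assumes "\<And>y. linear sC s (\<lambda>x. B x y)" "\<And>x. linear sC s (\<lambda>y. B x y)"
  shows "linear sC s (\<lambda>c. copr B c)"
proof -
  note lift = sweedler_coset[of sC "\<lambda>(x, y). B x y" sC, simplified, OF assms]
  have "copr B (c + c') = copr B c + copr B c'" for c c'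
  proof -
    obtain x y where "Delta E c = x +o tensor_null sC sC" "Delta E c' = y +o tensor_null sC sC"
      using Delta_coset by metis
    then show ?thesis
      by (simp add: copr_def Delta_add coset_add_coset[OF tensor_null_def] lift free_lift_add)
  qed
  moreover have "copr B (sC r c) = s r (copr B c)" for r c
  proof -
    obtain x where "Delta E c = x +o tensor_null sC sC" using Delta_coset by metis
    then show ?thesis
      by (simp add: copr_def Delta_scale quot_scale_coset[OF tensor_null_def] lift free_lift_free_scale)
  qed
  ultimately show ?thesis by (simp add: linear_iff vector_space_C vector_space_axioms)
qed

lemma linear_twist_left:
  assumes "\<And>y. linear sA s (\<lambda>x. B x y)" "\<And>x. linear sC s (\<lambda>y. B x y)"
  shows "linear sC s (\<lambda>c. twist B c a)"
proof -
  note lift = sweedler_coset[of sA "\<lambda>(x, y). B x y" sC, simplified, OF assms]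
  have "twist B (c + c') a = twist B c a + twist B c' a" for c c'
  proof -
    obtain x y where "ent E c a = x +o AC_null E" "ent E c' a = y +o AC_null E"
      using ent_coset by metis
    then show ?thesis
      by (simp add: twist_def ent_add_left coset_add_coset[OF tensor_null_def] lift free_lift_add)
  qed
  moreover have "twist B (sC r c) a = s r (twist B c a)" for r c
  proof -
    obtain x where "ent E c a = x +o AC_null E" using ent_coset by metis
    then show ?thesis
      by (simp add: twist_def ent_scale_left quot_scale_coset[OF tensor_null_def] lift free_lift_free_scale)
  qed
  ultimately show ?thesis by (simp add: linear_iff vector_space_C vector_space_axioms)
qed

lemma linear_twist_right:
  assumes "\<And>y. linear sA s (\<lambda>x. B x y)" "\<And>x. linear sC s (\<lambda>y. B x y)"
  shows "linear sA s (\<lambda>a. twist B c a)"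
proof -
  note lift = sweedler_coset[of sA "\<lambda>(x, y). B x y" sC, simplified, OF assms]
  have "twist B c (a + a') = twist B c a + twist B c a'" for a a'
  proof -
    obtain x y where "ent E c a = x +o AC_null E" "ent E c a' = y +o AC_null E"
      using ent_coset by metis
    then show ?thesis
      by (simp add: twist_def ent_add_right coset_add_coset[OF tensor_null_def] lift free_lift_add)
  qed
  moreover have "twist B c (sA r a) = s r (twist B c a)" for r a
  proof -
    obtain x where "ent E c a = x +o AC_null E" using ent_coset by metis
    then show ?thesis
      by (simp add: twist_def ent_scale_right quot_scale_coset[OF tensor_null_def] lift free_lift_free_scale)
  qed
  ultimately show ?thesis by (simp add: linear_iff vector_space_A vector_space_axioms)
qed

text \<open>Here the tensor, hence the representative, stays fixed and only the summand varies, so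
  bilinearity of \<open>B\<close> does not enter. In \<open>linear_copr\<close> the tensor itself
  varies and bilinearity is what makes the sum independent of the representative.\<close>

lemma linear_copr_body:
  assumes "\<And>x y. linear s' s (\<lambda>v. B v x y)"
  shows "linear s' s (\<lambda>v. copr (B v) c)"
  unfolding copr_def
  by (rule linear_sweedler) (use assms in \<open>auto simp: linear_iff split: prod.split\<close>)

lemma linear_twist_body:
  assumes "\<And>x y. linear s' s (\<lambda>v. B v x y)"
  shows "linear s' s (\<lambda>v. twist (B v) c a)"
  unfolding twist_def
  by (rule linear_sweedler) (use assms in \<open>auto simp: linear_iff split: prod.split\<close>)

lemma linear_pass_body:
  assumes "\<And>bs d. linear s' s (\<lambda>v. F v bs d)"
  shows "linear s' s (\<lambda>v. pass E s (F v) c as)"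
  using assms
proof (induction as arbitrary: F c)
  case (Cons a as)
  show ?case
    unfolding pass_Cons by (intro linear_twist_body Cons)
qed auto

lemma multilinearD: "multilinear F \<Longrightarrow> linear sA s (\<lambda>a. F (xs @ a # ys))"
  by (simp add: multilinear_def)

lemma multilinearD_Cons: "multilinear F \<Longrightarrow> linear sA s (\<lambda>a. F (a # ys))"
  using multilinearD[of F "[]"] by simp

lemma multilinear_Cons: "multilinear F \<Longrightarrow> multilinear (\<lambda>bs. F (x # bs))"
  unfolding multilinear_def append_Cons[symmetric] by blast

lemma multilinear_append_left: "multilinear F \<Longrightarrow> multilinear (\<lambda>bs. F (xs @ bs))"
  unfolding multilinear_def append_assoc[symmetric] by blast

lemma multilinear_append_right: "multilinear F \<Longrightarrow> multilinear (\<lambda>bs. F (bs @ ys))"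
  unfolding multilinear_def by (simp add: append_assoc)

lemma multilinear_body:
  assumes "\<And>xs ys. linear sA s (\<lambda>a. F (xs @ a # ys))"
  shows "multilinear F"
  using assms by (simp add: multilinear_def)

lemma linear_pass:
  assumes "\<And>d. multilinear (\<lambda>bs. F bs d)" "\<And>bs. linear sC s (\<lambda>d. F bs d)"
  shows "linear sC s (\<lambda>c. pass E s F c as)"
  using assms
proof (induction as arbitrary: F)
  case (Cons a as)
  show ?case unfolding pass_Cons
    by (intro linear_twist_left linear_pass_body Cons multilinearD_Cons multilinear_Cons)
qed simp

text \<open>The twists before the varying argument keep their tensors fixed. At that argument
  \<open>linear_twist_right\<close> applies; it requires the remaining \<open>pass\<close> to be
  linear in its coefficient, which is \<open>linear_pass\<close>.\<close>

lemma multilinear_pass: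
  assumes "\<And>d. multilinear (\<lambda>bs. F bs d)" "\<And>bs. linear sC s (\<lambda>d. F bs d)"
  shows "multilinear (\<lambda>as. pass E s F c as)"
proof (rule multilinear_body)
  fix xs ys
  show "linear sA s (\<lambda>a. pass E s F c (xs @ a # ys))"
    using assms
  proof (induction xs arbitrary: F c)
    case Nil
    then show ?case
      by (simp add: pass_Cons del: pass.simps)
        (intro linear_twist_right linear_pass_body multilinearD_Cons linear_pass multilinear_Cons)
  next
    case (Cons x xs)
    show ?case
      by (simp add: pass_Cons del: pass.simps)
        (intro linear_twist_body Cons multilinear_Cons)
  qed
qed

lemmas linear_intros = linear_copr linear_twist_left linear_twist_right linear_copr_body
  linear_twist_body linear_pass linear_pass_body multilinearD_Cons multilinear_pass

section \<open>Reordering of Sweedler sums\<close>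

lemma pass_sweedler:
  "pass E s (\<lambda>bs d. sweedler s (B bs d) t) c as = sweedler s (\<lambda>p. pass E s (\<lambda>bs d. B bs d p) c as) t"
proof (induction as arbitrary: B c)
  case (Cons a as)
  show ?case
    unfolding pass.simps Cons case_prod_unfold by (rule sweedler_commute)
qed simp

lemma pass_copr:
  "pass E s (\<lambda>bs d. copr (B bs d) c') c as = copr (\<lambda>x y. pass E s (\<lambda>bs d. B bs d x y) c as) c'"
  unfolding copr_def pass_sweedler by (rule arg_cong[of _ _ "\<lambda>f. sweedler s f _"]) auto

lemma pass_twist:
  "pass E s (\<lambda>bs d. twist (B bs d) c' a) c as = twist (\<lambda>x y. pass E s (\<lambda>bs d. B bs d x y) c as) c' a"
  unfolding twist_def pass_sweedler by (rule arg_cong[of _ _ "\<lambda>f. sweedler s f _"]) auto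

lemma pass_pass:
  "pass E s (\<lambda>bs d. pass E s (B bs d) c' as') c as = pass E s (\<lambda>bs' d'. pass E s (\<lambda>bs d. B bs d bs' d') c as) c' as'"
proof (induction as' arbitrary: B c')
  case (Cons a as')
  show ?case by (simp only: pass_Cons pass_twist Cons)
qed simp

lemma pass_append: "pass E s F c (as @ as') = pass E s (\<lambda>bs d. pass E s (\<lambda>bs'. F (bs @ bs')) d as') c as"
  by (induction as arbitrary: F c) simp_all

text \<open>Twisting preserves the number of arguments; this makes length conditions on cochains
  available under \<open>pass\<close>.\<close>

lemma pass_cong:
  assumes "as = as'" "c = c'" "\<And>bs d. length bs = length as' \<Longrightarrow> F bs d = G bs d"
  shows "pass E s F c as = pass E s G c' as'"
  unfolding assms(1,2) using assms(3)
proof (induction as' arbitrary: F G c')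
  case (Cons a as)
  have "pass E s (\<lambda>bs. F (x # bs)) d as = pass E s (\<lambda>bs. G (x # bs)) d as" for x d
    by (rule Cons) (simp add: Cons)
  then show ?case by (simp add: twist_def)
qed simp

lemma
  assumes "linear s s' L" "entwining_target E s'"
  shows linear_copr_comp: "L (copr B c) = entwining_target.copr E s' (\<lambda>x y. L (B x y)) c"
    and linear_twist_comp: "L (twist A c a) = entwining_target.twist E s' (\<lambda>x y. L (A x y)) c a"
  using assms(2)
  by (simp_all add: entwining_target.copr_def entwining_target.twist_def copr_def twist_def
      linear_sweedler_comp[OF assms(1)] case_prod_unfold)

lemma linear_pass_comp:
  assumes "linear s s' L"
  shows "L (pass E s F c as) = pass E s' (\<lambda>bs d. L (F bs d)) c as"
proof (induction as arbitrary: F c)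
  case (Cons a as)
  then show ?case by (simp add: linear_sweedler_comp[OF assms] case_prod_unfold)
qed simp

section \<open>The axioms evaluated on multilinear maps\<close>

lemma coassoc:
  assumes "\<And>y z. linear sC s (\<lambda>x. T x y z)" "\<And>x z. linear sC s (\<lambda>y. T x y z)"
    "\<And>x y. linear sC s (\<lambda>z. T x y z)"
  shows "copr (\<lambda>x y. copr (\<lambda>u v. T u v y) x) c = copr (\<lambda>x y. copr (\<lambda>u v. T x u v) y) c"
proof -
  have "sweedler free_scale (\<lambda>(c1, c2).
             sweedler free_scale (\<lambda>(c11, c12). gen (c11, c12, c2)) (Delta E c1)) (Delta E c) +o tensor3_null sC sC sC
       = sweedler free_scale (\<lambda>(c1, c2).
             sweedler free_scale (\<lambda>(c21, c22). gen (c1, c21, c22)) (Delta E c2)) (Delta E c) +o tensor3_null sC sC sC"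
    using coalgebra by (simp add: is_coalgebra_def)
  then have "sweedler free_scale (\<lambda>(c1, c2).
             sweedler free_scale (\<lambda>(c11, c12). gen (c11, c12, c2)) (Delta E c1)) (Delta E c)
       - sweedler free_scale (\<lambda>(c1, c2).
             sweedler free_scale (\<lambda>(c21, c22). gen (c1, c21, c22)) (Delta E c2)) (Delta E c) \<in> tensor3_null sC sC sC"
    by (simp only: span_coset_eq_iff[OF tensor3_null_def])
  \<comment> \<open>The linear extension of \<open>T\<close> vanishes on the difference of the two
    formal sums and, being linear, moves inside the nested Sweedler sums down to the
    generators.\<close>
  from free_lift_tensor3_null[OF _ _ _ this, of "\<lambda>(x, y, z). T x y z"] assms
  show ?thesis
    by (simp add: free_lift_diff linear_sweedler_comp[OF linear_free_lift] copr_def case_prod_unfold)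
qed

lemma counit_left:
  assumes "linear sC s L"
  shows "copr (\<lambda>x y. s (eps E x) (L y)) c = L c"
proof -
  have "L (sweedler sC (\<lambda>(c1, c2). sC (eps E c1) c2) (Delta E c)) = L c"
    using coalgebra by (simp add: is_coalgebra_def)
  then show ?thesis
    using assms by (simp add: linear_sweedler_comp[OF assms] copr_def case_prod_unfold linear_iff)
qed

lemma counit_right:
  assumes "linear sC s L"
  shows "copr (\<lambda>x y. s (eps E y) (L x)) c = L c"
proof -
  have "L (sweedler sC (\<lambda>(c1, c2). sC (eps E c2) c1) (Delta E c)) = L c"
    using coalgebra by (simp add: is_coalgebra_def)
  then show ?thesis
    using assms by (simp add: linear_sweedler_comp[OF assms] copr_def case_prod_unfold linear_iff)
qed

lemma twist_mult:
  assumes "\<And>y. linear sA s (\<lambda>x. B x y)" "\<And>x. linear sC s (\<lambda>y. B x y)"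
  shows "twist B c (a * a') = twist (\<lambda>x c'. twist (\<lambda>y. B (x * y)) c' a') c a"
proof -
  have "ent E c (a * a') =
       sweedler free_scale (\<lambda>(x, c').
         sweedler free_scale (\<lambda>(y, c''). gen (x * y, c'')) (ent E c' a')) (ent E c a) +o AC_null E"
    using entwining by (simp add: entwining_structure_def)
  then show ?thesis using assms
    by (simp add: twist_def sweedler_coset linear_sweedler_comp[OF linear_free_lift] case_prod_unfold)
qed

lemma twist_eps:
  assumes "linear sA s L"
  shows "twist (\<lambda>x c'. s (eps E c') (L x)) c a = s (eps E c) (L a)"
proof -
  have "L (sweedler sA (\<lambda>(x, c'). sA (eps E c') x) (ent E c a)) = L (sA (eps E c) a)"
    using entwining by (simp add: entwining_structure_def)
  then show ?thesis
    using assms by (simp add: linear_sweedler_comp[OF assms] twist_def case_prod_unfold linear_iff)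
qed

lemma twist_copr:
  assumes "\<And>y z. linear sA s (\<lambda>x. T x y z)" "\<And>x z. linear sC s (\<lambda>y. T x y z)"
    "\<And>x y. linear sC s (\<lambda>z. T x y z)"
  shows "twist (\<lambda>x c'. copr (T x) c') c a
    = copr (\<lambda>c1 c2. twist (\<lambda>x c2'. twist (\<lambda>y c1'. T y c1' c2') c1 x) c2 a) c"
proof -
  have "sweedler free_scale (\<lambda>(x, c').
         sweedler free_scale (\<lambda>(c1, c2). gen (x, c1, c2)) (Delta E c')) (ent E c a) +o ACC_null E
     = sweedler free_scale (\<lambda>(c1, c2).
         sweedler free_scale (\<lambda>(x, c2').
           sweedler free_scale (\<lambda>(y, c1'). gen (y, c1', c2')) (ent E c1 x)) (ent E c2 a)) (Delta E c)
         +o ACC_null E"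
    using entwining by (simp add: entwining_structure_def)
  then have "sweedler free_scale (\<lambda>(x, c').
         sweedler free_scale (\<lambda>(c1, c2). gen (x, c1, c2)) (Delta E c')) (ent E c a)
     - sweedler free_scale (\<lambda>(c1, c2).
         sweedler free_scale (\<lambda>(x, c2').
           sweedler free_scale (\<lambda>(y, c1'). gen (y, c1', c2')) (ent E c1 x)) (ent E c2 a)) (Delta E c)
         \<in> ACC_null E"
    by (simp only: span_coset_eq_iff[OF tensor3_null_def])
  from free_lift_tensor3_null[OF _ _ _ this, of "\<lambda>(x, y, z). T x y z"] assms
  show ?thesis
    by (simp add: free_lift_diff linear_sweedler_comp[OF linear_free_lift] copr_def twist_def case_prod_unfold)
qed

end

section \<open>Compositions of cochains\<close>

sublocale entwining \<subseteq> A: entwining_target E "scA E"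
  by unfold_locales (use vector_space_A in \<open>auto simp: vector_space_def\<close>)

context entwining
begin

lemma cochain_linear: "f \<in> cochains E n \<Longrightarrow> linear sC sA (\<lambda>c. f c as)"
  by (cases "length as = n") (simp_all add: cochains_def linear_iff vector_space_C vector_space_A)

lemma cochain_multilinear: "f \<in> cochains E n \<Longrightarrow> A.multilinear (\<lambda>as. f c as)"
proof (rule A.multilinear_body)
  fix xs ys assume "f \<in> cochains E n"
  then show "linear sA sA (\<lambda>a. f c (xs @ a # ys))"
    by (cases "length xs + 1 + length ys = n") (simp_all add: cochains_def linear_iff vector_space_A)
qed

lemma cochain_eq_0: "f \<in> cochains E n \<Longrightarrow> length as \<noteq> n \<Longrightarrow> f c as = 0"
  by (simp add: cochains_def)

lemma cochainsI:
  assumes "\<And>c as. length as \<noteq> n \<Longrightarrow> f c as = 0" "\<And>as. linear sC sA (\<lambda>c. f c as)"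
    "\<And>c xs a ys. length xs + 1 + length ys = n \<Longrightarrow> linear sA sA (\<lambda>a. f c (xs @ a # ys))"
  shows "f \<in> cochains E n"
  using assms by (simp add: cochains_def)

lemma equivariant_cochain: "f \<in> equivariant_cochains E n \<Longrightarrow> f \<in> cochains E n"
  by (simp add: equivariant_cochains_def)

end

section \<open>Coproducts passing a list of arguments, and the effect of equivariance\<close>

context entwining_target
begin

lemma multilinear_cochain_comp:
  assumes "f \<in> cochains E n" "linear sA s L"
  shows "multilinear (\<lambda>as. L (f c as))"
  by (rule multilinear_body) (rule linear_comp[OF A.multilinearD[OF cochain_multilinear[OF assms(1)]] assms(2)])

lemma linear_cochain_comp:
  assumes "f \<in> cochains E n" "linear sA s L"
  shows "linear sC s (\<lambda>c. L (f c as))"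
  by (rule linear_comp[OF cochain_linear[OF assms(1)] assms(2)])

text \<open>The compatibility of \<psi> with \<Delta>, iterated along a list:
  \<open>twist_copr\<close> carries the coproduct across the head. The second leg meets the
  arguments first, and the first leg passes the arguments already twisted.\<close>

lemma pass_comult:
  assumes "\<And>x y. multilinear (\<lambda>bs. F bs x y)" "\<And>bs y. linear sC s (\<lambda>x. F bs x y)"
    "\<And>bs x. linear sC s (\<lambda>y. F bs x y)"
  shows "pass E s (\<lambda>bs d. copr (\<lambda>x y. F bs x y) d) c as
    = copr (\<lambda>c1 c2. pass E s (\<lambda>bs2 d2. pass E s (\<lambda>bs1 d1. F bs1 d1 d2) c1 bs2) c2 as) c"
  using assms
proof (induction as arbitrary: F c)
  case (Cons a as)
  have "pass E s (\<lambda>bs d. copr (F bs) d) c (a # as)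
      = twist (\<lambda>x c'. copr (\<lambda>d1 d2. pass E s (\<lambda>bs2 d2'. pass E s (\<lambda>bs1 d1'. F (x # bs1) d1' d2') d1 bs2) d2 as) c') c a"
    unfolding pass_Cons by (subst Cons.IH) (intro Cons.prems multilinear_Cons refl)+
  also have "\<dots> = copr (\<lambda>c1 c2. twist (\<lambda>y c2'. twist (\<lambda>x c1'.
      pass E s (\<lambda>bs2 d2'. pass E s (\<lambda>bs1 d1'. F (x # bs1) d1' d2') c1' bs2) c2' as) c1 y) c2 a) c"
    by (rule twist_copr) (intro linear_intros Cons.prems multilinear_Cons)+
  finally show ?case
    \<comment> \<open>After \<open>twist_copr\<close> the first leg meets the head before the second
      leg has passed the tail; \<open>pass_twist\<close> exchanges these independent sums.\<close>
    by (simp add: pass_Cons pass_twist del: pass.simps(2))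
qed simp

text \<open>Coassociativity regroups the three legs so that the two successive passes over
  \<open>as\<close> are made by the halves of one element; \<open>pass_comult\<close> then merges
  them into a single pass followed by a coproduct. Every associativity argument for compositions
  reduces to this.\<close>

lemma copr_pass_copr:
  assumes "\<And>bs x y. linear sC s (\<lambda>z. G z bs x y)" "\<And>z x y. multilinear (\<lambda>bs. G z bs x y)"
    "\<And>z bs y. linear sC s (\<lambda>x. G z bs x y)" "\<And>z bs x. linear sC s (\<lambda>y. G z bs x y)"
  shows "copr (\<lambda>c1 c2. pass E s (\<lambda>bs y. copr (\<lambda>c11 c12. pass E s (\<lambda>bs' x. G c11 bs' x y) c12 bs) c1) c2 as) c
    = copr (\<lambda>c1 c2. pass E s (\<lambda>bs d. copr (\<lambda>x y. G c1 bs x y) d) c2 as) c"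
proof -
  have "copr (\<lambda>c1 c2. pass E s (\<lambda>bs y. copr (\<lambda>c11 c12. pass E s (\<lambda>bs' x. G c11 bs' x y) c12 bs) c1) c2 as) c
      = copr (\<lambda>c1 c2. copr (\<lambda>c11 c12. pass E s (\<lambda>bs y. pass E s (\<lambda>bs' x. G c11 bs' x y) c12 bs) c2 as) c1) c"
    by (simp only: pass_copr)
  also have "\<dots> = copr (\<lambda>c1 c2. copr (\<lambda>c11 c12. pass E s (\<lambda>bs y. pass E s (\<lambda>bs' x. G c1 bs' x y) c11 bs) c12 as) c2) c"
    by (rule coassoc) (intro linear_intros assms)+
  also have "\<dots> = copr (\<lambda>c1 c2. pass E s (\<lambda>bs d. copr (\<lambda>x y. G c1 bs x y) d) c2 as) c"
    by (subst pass_comult) (intro assms refl)+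
  finally show ?thesis .
qed

text \<open>The defining equation of equivariance holds modulo the null space of A \<otimes> C, so
  it is pushed along the linear extension of a bilinear \<open>B\<close> into the target.\<close>

lemma equivariantD:
  assumes f: "f \<in> equivariant_cochains E n" and len: "length as = n"
    and B: "\<And>y. linear sA s (\<lambda>x. B x y)" "\<And>x. linear sC s (\<lambda>y. B x y)"
  shows "copr (\<lambda>c1 c2. twist B c1 (f c2 as)) c
    = copr (\<lambda>c1 c2. pass E s (\<lambda>bs d. B (f c1 bs) d) c2 as) c"
proof -
  interpret F: entwining_target E free_scale
    using entwining_axioms vector_space_free_scale by (rule entwining_target.intro)
  have "F.copr (\<lambda>c1 c2. pass E free_scale (\<lambda>bs c'. gen (f c1 bs, c')) c2 as) c
      - F.copr (\<lambda>c1 c2. F.twist (\<lambda>x c'. gen (x, c')) c1 (f c2 as)) c \<in> AC_null E"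
    using f len
    by (simp add: equivariant_cochains_def F.copr_def F.twist_def span_coset_eq_iff[OF tensor_null_def])
  from free_lift_tensor_null[OF _ _ this, of "\<lambda>(x, y). B x y"] B
  show ?thesis
    by (simp add: free_lift_diff F.linear_copr_comp[OF linear_free_lift entwining_target_axioms]
        F.linear_twist_comp[OF linear_free_lift entwining_target_axioms] F.linear_pass_comp[OF linear_free_lift])
qed

text \<open>Both sides of the parallel composition axiom, and of the equivariance of a composition, are
  instances of the two left-hand sides below.\<close>

lemma
  assumes F: "\<And>q d. linear sC s (\<lambda>c. F c q d)" "\<And>c d. multilinear (\<lambda>q. F c q d)"
    "\<And>c q. linear sC s (\<lambda>d. F c q d)"
    and g: "g \<in> equivariant_cochains E n" and len: "length mid = n"
  shows copr_pass_through:
    "copr (\<lambda>c1 c2. pass E s (\<lambda>bs d. copr (\<lambda>c11 c12. pass E s (F c11) c12 (bs @ g d mid # post)) c1) c2 pre) c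
      = copr (\<lambda>c1 c2. pass E s (\<lambda>bs e. copr (\<lambda>e1 e2. pass E s (\<lambda>bm d. pass E s (\<lambda>bs'. F c1 (bs @ g e1 bm # bs')) d post)
          e2 mid) e) c2 pre) c" (is ?thesis1)
    and copr_pass_insert:
    "copr (\<lambda>c1 c2. pass E s (\<lambda>bs e. pass E s (\<lambda>bm e'. pass E s (\<lambda>bs' d.
          copr (\<lambda>c11 c12. pass E s (\<lambda>bs e. F c11 (bs @ g e bm # bs') d) c12 bs) c1) e' post) e mid) c2 pre) c
      = copr (\<lambda>c1 c2. pass E s (\<lambda>bs e. copr (\<lambda>e1 e2. pass E s (\<lambda>bm d. pass E s (\<lambda>bs'. F c1 (bs @ g e1 bm # bs')) d post)
          e2 mid) e) c2 pre) c" (is ?thesis2)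
proof -
  note gc = equivariant_cochain[OF g]
  have lin: "linear sA s (\<lambda>x. F c (bs @ x # bs') d)" for c bs bs' d
    by (rule multilinearD) (rule F)
  have lin': "linear sA s (\<lambda>x. F c ((xs @ x # ys) @ y # bs') d)" for c xs ys y bs' d
    using multilinearD[OF F(2), of _ xs "ys @ y # bs'"] by simp
  have ml: "multilinear (\<lambda>bs'. F c (bs @ x # bs') d)" for c bs x d
    using multilinear_append_left[OF F(2), of _ "bs @ [x]"] by simp
  have mlg: "multilinear (\<lambda>bm. pass E s (\<lambda>bs'. F c (bs @ g e bm # bs')) d post)" for c bs e d
    by (rule multilinear_cochain_comp[OF gc, where L = "\<lambda>x. pass E s (\<lambda>bs'. F c (bs @ x # bs')) d post"])
      (intro linear_intros lin)
  have ling: "linear sC s (\<lambda>e. pass E s (\<lambda>bs'. F c (bs @ g e bm # bs')) d post)" for c bs bm d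
    by (rule linear_cochain_comp[OF gc, where L = "\<lambda>x. pass E s (\<lambda>bs'. F c (bs @ x # bs')) d post"])
      (intro linear_intros lin)
  let ?P = "\<lambda>c bs x d. pass E s (\<lambda>bs'. F c (bs @ x # bs')) d post"
  \<comment> \<open>The pass over the whole list is cut at the entry \<open>g d mid\<close>, which
    contributes one twist.\<close>
  have "copr (\<lambda>c1 c2. pass E s (\<lambda>bs d. copr (\<lambda>c11 c12. pass E s (F c11) c12 (bs @ g d mid # post)) c1) c2 pre) c
    = copr (\<lambda>c1 c2. pass E s (\<lambda>bs d. copr (\<lambda>c11 c12. pass E s (\<lambda>bs' e. twist (?P c11 bs') e (g d mid)) c12 bs) c1) c2 pre) c"
    by (simp add: pass_append pass_Cons del: pass.simps(2))
  also have "\<dots> = copr (\<lambda>c1 c2. pass E s (\<lambda>bs d. copr (\<lambda>x y. twist (?P c1 bs) x (g y mid)) d) c2 pre) c"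
  proof (rule copr_pass_copr)
    show "linear sC s (\<lambda>z. twist (?P z bs) x (g y mid))" for bs x y
      by (intro linear_intros F)
    show "multilinear (\<lambda>bs. twist (?P z bs) x (g y mid))" for x y z
      by (rule multilinear_body) (intro linear_intros lin')
    show "linear sC s (\<lambda>x. twist (?P z bs) x (g y mid))" for bs y z
      by (intro linear_intros F lin ml)
    show "linear sC s (\<lambda>y. twist (?P z bs) x (g y mid))" for bs x z
      by (rule linear_cochain_comp[OF gc]) (intro linear_intros F lin ml)
  qed
  \<comment> \<open>The twist of the value of \<open>g\<close> and the coefficient inside
    \<open>g\<close> now come from the same coproduct, so equivariance of \<open>g\<close> replaces
    the twist by a pass over \<open>mid\<close>.\<close>
  also have "\<dots> = copr (\<lambda>c1 c2. pass E s (\<lambda>bs e. copr (\<lambda>e1 e2. pass E s (\<lambda>bm d. ?P c1 bs (g e1 bm) d)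
          e2 mid) e) c2 pre) c"
    by (subst equivariantD[OF g len]) (intro linear_intros F lin ml refl)+
  finally show ?thesis1 .
  \<comment> \<open>Here \<open>mid\<close> is already being passed. Reordering the sums suffices to
    reach the situation of \<open>copr_pass_copr\<close>.\<close>
  have "copr (\<lambda>c1 c2. pass E s (\<lambda>bs e. pass E s (\<lambda>bm e'. pass E s (\<lambda>bs' d.
          copr (\<lambda>c11 c12. pass E s (\<lambda>bs e. F c11 (bs @ g e bm # bs') d) c12 bs) c1) e' post) e mid) c2 pre) c
     = copr (\<lambda>c1 c2. pass E s (\<lambda>bs e. copr (\<lambda>c11 c12. pass E s (\<lambda>bs' x.
          pass E s (\<lambda>bm d. ?P c11 bs' (g x bm) d) e mid) c12 bs) c1) c2 pre) c"
    by (simp only: pass_copr) (subst pass_pass, subst pass_pass, rule refl)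
  also have "\<dots> = copr (\<lambda>c1 c2. pass E s (\<lambda>bs e. copr (\<lambda>e1 e2. pass E s (\<lambda>bm d. ?P c1 bs (g e1 bm) d)
          e2 mid) e) c2 pre) c"
  proof (rule copr_pass_copr)
    show "linear sC s (\<lambda>z. pass E s (\<lambda>bm d. ?P z bs (g x bm) d) y mid)" for bs x y
      by (intro linear_intros F)
    show "multilinear (\<lambda>bs. pass E s (\<lambda>bm d. ?P z bs (g x bm) d) y mid)" for x y z
      by (rule multilinear_body) (intro linear_intros lin')
    show "linear sC s (\<lambda>x. pass E s (\<lambda>bm d. ?P z bs (g x bm) d) y mid)" for bs y z
      by (intro linear_pass_body ling)
    show "linear sC s (\<lambda>y. pass E s (\<lambda>bm d. ?P z bs (g x bm) d) y mid)" for bs x z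
      by (intro linear_pass mlg F ml)
  qed
  finally show ?thesis2 .
qed

end

context entwining_target
begin

lemma copr_zero [simp]: "copr (\<lambda>x y. 0) c = 0"
  by (simp add: copr_def sweedler_def case_prod_unfold)

lemma pass_zero [simp]: "pass E s (\<lambda>bs d. 0) c as = 0"
  by (induction as arbitrary: c) (simp_all add: sweedler_def case_prod_unfold)

lemma pass_eps:
  assumes "multilinear L"
  shows "pass E s (\<lambda>bs d. s (eps E d) (L bs)) c as = s (eps E c) (L as)"
  using assms
proof (induction as arbitrary: L c)
  case (Cons a as)
  then show ?case
    by (simp add: pass_Cons multilinear_Cons twist_eps[of "\<lambda>x. L (x # as)"] multilinearD_Cons del: pass.simps)
qed simp

end

section \<open>Operad axioms for the insertion of cochains\<close>

context entwining
begin

text \<open>Three named blocks replace \<open>take\<close> and \<open>drop\<close>. No assumption on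
  \<open>post\<close> is needed for rewriting: if the total length is wrong, \<open>f\<close>
  receives a list of the wrong length and both sides are 0.\<close>

lemma diamond_at_append:
  assumes f: "f \<in> cochains E m" and "length pre = i" "length mid = n" "i < m"
  shows "diamond_at E m n i f g c (pre @ mid @ post)
    = A.copr (\<lambda>c1 c2. pass E sA (\<lambda>bs d. f c1 (bs @ g d mid # post)) c2 pre) c"
proof (cases "length (pre @ mid @ post) = m + n - 1")
  case True
  with assms show ?thesis by (simp add: diamond_at_def A.copr_def)
next
  case False
  have "pass E sA (\<lambda>bs d. f c1 (bs @ g d mid # post)) c2 pre = pass E sA (\<lambda>bs d. 0) c2 pre" for c1 c2
    by (rule A.pass_cong) (use False assms in \<open>auto intro!: cochain_eq_0[OF f]\<close>)
  with False show ?thesis by (simp add: diamond_at_def)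
qed

lemma list_split3:
  assumes "length as = i + n + l"
  obtains pre mid post where "as = pre @ mid @ post" "length pre = i" "length mid = n" "length post = l"
  by (rule that[of "take i as" "take n (drop i as)" "drop n (drop i as)"])
    (use assms in \<open>simp_all del: drop_drop\<close>)

lemma linear_cochain_append:
  "f \<in> cochains E n \<Longrightarrow> linear sA sA (\<lambda>a. f c (xs @ a # ys))"
  by (rule A.multilinearD[OF cochain_multilinear])

lemma linear_zero: "vector_space s \<Longrightarrow> vector_space s' \<Longrightarrow> linear s s' (\<lambda>x. 0)"
  by (simp add: linear_iff module.scale_zero_right flip: module_iff_vector_space)

lemma diamond_at_cochain:
  assumes f: "f \<in> cochains E m" and g: "g \<in> cochains E n" and i: "i < m"
  shows "diamond_at E m n i f g \<in> cochains E (m + n - 1)"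
proof (rule cochainsI)
  show "diamond_at E m n i f g c as = 0" if "length as \<noteq> m + n - 1" for c as
    using that by (simp add: diamond_at_def)
next
  fix as
  show "linear sC sA (\<lambda>c. diamond_at E m n i f g c as)"
  proof (cases "length as = m + n - 1")
    case True
    then have "length as = i + n + (m - i - 1)" using i by simp
    then obtain pre mid post where *: "as = pre @ mid @ post" "length pre = i" "length mid = n"
      using list_split3 by metis
    have "A.multilinear (\<lambda>bs. f c (bs @ x # post))" for c x
      by (rule A.multilinear_append_right[OF cochain_multilinear[OF f]])
    moreover have "linear sC sA (\<lambda>d. f c (bs @ g d mid # post))" for c bs
      by (rule linear_comp[OF cochain_linear[OF g] linear_cochain_append[OF f]])
    ultimately show ?thesis
      unfolding *(1) diamond_at_append[OF f *(2,3) i]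
      by (intro A.linear_intros cochain_linear[OF f])
  qed (simp add: diamond_at_def linear_zero vector_space_A vector_space_C)
next
  fix c and xs ys :: "'a list"
  assume len: "length xs + 1 + length ys = m + n - 1"
  note app = diamond_at_append[OF f _ _ i]
  \<comment> \<open>The varying argument lies before, inside or after the block given to
    \<open>g\<close>. Before it, the argument is twisted and \<open>multilinear_pass\<close> is
    required; inside it, linearity of \<open>g\<close> is composed with that of
    \<open>f\<close>.\<close>
  consider "length xs < i" | "i \<le> length xs" "length xs < i + n" | "i + n \<le> length xs" by linarith
  then show "linear sA sA (\<lambda>a. diamond_at E m n i f g c (xs @ a # ys))"
  proof cases
    case 1
    then have "length ys = (i - length xs - 1) + n + (m - i - 1)" using len i by simp
    then obtain pre mid post where ys: "ys = pre @ mid @ post" "length pre = i - length xs - 1" "length mid = n"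
      using list_split3 by metis
    have "diamond_at E m n i f g c (xs @ a # ys) = A.copr (\<lambda>c1 c2. pass E sA (\<lambda>bs d. f c1 (bs @ g d mid # post)) c2 (xs @ a # pre)) c" for a
      using app[of "xs @ a # pre" mid n g c post] ys 1 by simp
    moreover have "A.multilinear (\<lambda>bs. f c (bs @ x # post))" for c x
      by (rule A.multilinear_append_right[OF cochain_multilinear[OF f]])
    moreover have "linear sC sA (\<lambda>d. f c (bs @ g d mid # post))" for c bs
      by (rule linear_comp[OF cochain_linear[OF g] linear_cochain_append[OF f]])
    ultimately show ?thesis
      by simp (intro A.linear_copr_body A.multilinearD A.multilinear_pass)
  next
    case 2
    obtain pre mid where xs: "xs = pre @ mid" "length pre = i"
      by (rule that[of "take i xs" "drop i xs"]) (use 2 in auto)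
    \<comment> \<open>The number of arguments of \<open>g\<close> that follow the varying
      one.\<close>
    define k where "k = i + n - length xs - 1"
    obtain mid' post where ys: "ys = mid' @ post" "length mid' = k"
      by (rule that[of "take k ys" "drop k ys"]) (use len i 2 in \<open>auto simp: k_def\<close>)
    have "diamond_at E m n i f g c (xs @ a # ys) = A.copr (\<lambda>c1 c2. pass E sA (\<lambda>bs d. f c1 (bs @ g d (mid @ a # mid') # post)) c2 pre) c" for a
      using app[of pre "mid @ a # mid'" n g c post] xs ys 2 by (simp add: k_def)
    then show ?thesis
      by simp (intro A.linear_copr_body A.linear_pass_body
          linear_comp[OF linear_cochain_append[OF g] linear_cochain_append[OF f]])
  next
    case 3
    then have "length xs = i + n + (length xs - i - n)" by simp
    then obtain pre mid post where xs: "xs = pre @ mid @ post" "length pre = i" "length mid = n"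
      using list_split3 by metis
    have "diamond_at E m n i f g c (xs @ a # ys) = A.copr (\<lambda>c1 c2. pass E sA (\<lambda>bs d. f c1 (bs @ g d mid # post @ a # ys)) c2 pre) c" for a
      using app[of pre mid n g c "post @ a # ys"] xs by simp
    moreover have "linear sA sA (\<lambda>a. f c1 (bs @ g d mid # post @ a # ys))" for c1 bs d
      using linear_cochain_append[OF f, of c1 "bs @ g d mid # post" ys] by simp
    ultimately show ?thesis
      by simp (intro A.linear_copr_body A.linear_pass_body)
  qed
qed

lemma diamond_at_nested:
  assumes f: "f \<in> cochains E m" and g: "g \<in> cochains E n" and h: "h \<in> cochains E p"
    and i: "i < m" and l: "l < n"
  shows "diamond_at E (m + n - 1) p (i + l) (diamond_at E m n i f g) h
    = diamond_at E m (n + p - 1) i f (diamond_at E n p l g h)"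
proof (intro ext)
  fix c as
  show "diamond_at E (m + n - 1) p (i + l) (diamond_at E m n i f g) h c as
    = diamond_at E m (n + p - 1) i f (diamond_at E n p l g h) c as"
  proof (cases "length as = m + (n + p - 1) - 1")
    case False
    moreover have "m + n - 1 + p - 1 = m + (n + p - 1) - 1" using i l by simp
    ultimately show ?thesis by (simp only: diamond_at_def not_False_eq_True if_True)
  next
    case True
    then have "length as = i + (n + p - 1) + (m - i - 1)" using i l by simp
    then obtain pre mid post where as: "as = pre @ mid @ post" "length pre = i" "length mid = n + p - 1"
      using list_split3 by metis
    then have "length mid = l + p + (n - l - 1)" using l by simp
    then obtain pre' mid' post' where mid: "mid = pre' @ mid' @ post'" "length pre' = l" "length mid' = p"
        "length post' = n - l - 1"
      using list_split3 by metis
    note fg = diamond_at_cochain[OF f g i]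
    have il: "i + l < m + n - 1" using i l by simp
    let ?G = "\<lambda>c bs x y. pass E sA (\<lambda>bs' d. f c (bs @ g x (bs' @ h d mid' # post') # post)) y pre'"
    have "diamond_at E (m + n - 1) p (i + l) (diamond_at E m n i f g) h c as
      = A.copr (\<lambda>c1 c2. pass E sA (\<lambda>bs e. pass E sA (\<lambda>bs' d.
          diamond_at E m n i f g c1 (bs @ (bs' @ h d mid' # post') @ post)) e pre') c2 pre) c"
      using diamond_at_append[OF fg, of "pre @ pre'" "i + l" mid' p h c "post' @ post"] as mid il
      by (simp add: A.pass_append)
    also have "\<dots> = A.copr (\<lambda>c1 c2. pass E sA (\<lambda>bs e. pass E sA (\<lambda>bs' d.
          A.copr (\<lambda>c11 c12. pass E sA (\<lambda>bs e. f c11 (bs @ g e (bs' @ h d mid' # post') # post)) c12 bs) c1) e pre') c2 pre) c"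
      using as mid l
      by (intro arg_cong[of _ _ "\<lambda>B. A.copr B c"] ext A.pass_cong diamond_at_append[OF f _ _ i] refl) auto
    also have "\<dots> = A.copr (\<lambda>c1 c2. pass E sA (\<lambda>bs e. A.copr (\<lambda>c11 c12. pass E sA (\<lambda>bs' x. ?G c11 bs' x e) c12 bs) c1) c2 pre) c"
      by (simp only: A.pass_copr) (subst A.pass_pass, rule refl)
    \<comment> \<open>So far \<open>c1\<close> is split between \<open>f\<close> and
      \<open>g\<close> while \<open>c2\<close> goes on to \<open>h\<close>. Afterwards
      \<open>f\<close> gets \<open>c1\<close>, and the coefficient that has passed
      \<open>pre\<close> is split between \<open>g\<close> and \<open>h\<close>, as in the composite
      of \<open>g\<close> with \<open>h\<close>.\<close>
    also have "\<dots> = A.copr (\<lambda>c1 c2. pass E sA (\<lambda>bs d. A.copr (\<lambda>x y. ?G c1 bs x y) d) c2 pre) c"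
    proof (rule A.copr_pass_copr)
      show "linear sC sA (\<lambda>z. ?G z bs x y)" for bs x y
        by (intro A.linear_intros cochain_linear[OF f])
      show "A.multilinear (\<lambda>bs. ?G z bs x y)" for x y z
        by (rule A.multilinear_body, intro A.linear_pass_body, simp) (rule linear_cochain_append[OF f])
      show "linear sC sA (\<lambda>x. ?G z bs x y)" for bs y z
        by (intro A.linear_pass_body linear_comp[OF cochain_linear[OF g] linear_cochain_append[OF f]])
      show "linear sC sA (\<lambda>y. ?G z bs x y)" for bs x z
      proof (rule A.linear_pass)
        show "A.multilinear (\<lambda>bs'. f z (bs @ g x (bs' @ h d mid' # post') # post))" for d
          by (rule A.multilinear_append_right[where F = "\<lambda>bs'. f z (bs @ g x bs' # post)"])
            (rule A.multilinear_cochain_comp[OF g linear_cochain_append[OF f]])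
        show "linear sC sA (\<lambda>d. f z (bs @ g x (bs' @ h d mid' # post') # post))" for bs'
          by (rule A.linear_cochain_comp[OF h])
            (rule linear_comp[OF linear_cochain_append[OF g] linear_cochain_append[OF f]])
      qed
    qed
    also have "\<dots> = A.copr (\<lambda>c1 c2. pass E sA (\<lambda>bs d. f c1 (bs @ diamond_at E n p l g h d mid # post)) c2 pre) c"
      using mid
      by (simp add: diamond_at_append[OF g _ _ l] A.linear_pass_comp[OF linear_cochain_append[OF f]]
          A.linear_copr_comp[OF linear_cochain_append[OF f] A.entwining_target_axioms])
    also have "\<dots> = diamond_at E m (n + p - 1) i f (diamond_at E n p l g h) c as"
      using as by (simp add: diamond_at_append[OF f _ _ i])
    finally show ?thesis .
  qed
qed

text \<open>Equivariance is asked of the operation inserted further left, whose value or arguments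
  are crossed by the coefficient for \<open>g\<close>. Replacing argument \<open>j\<close> by
  \<open>p\<close> arguments moves argument \<open>i\<close> to \<open>i + p - 1\<close>; since
  \<open>j < i\<close> this is correct also for \<open>p = 0\<close>.\<close>

lemma diamond_at_parallel:
  assumes f: "f \<in> cochains E m" and g: "g \<in> cochains E n" and h: "h \<in> equivariant_cochains E p"
    and j: "j < i" and i: "i < m"
  shows "diamond_at E (m + n - 1) p j (diamond_at E m n i f g) h
    = diamond_at E (m + p - 1) n (i + p - 1) (diamond_at E m p j f h) g"
proof (intro ext)
  fix c as
  show "diamond_at E (m + n - 1) p j (diamond_at E m n i f g) h c as
    = diamond_at E (m + p - 1) n (i + p - 1) (diamond_at E m p j f h) g c as"
  proof (cases "length as = m + n - 1 + p - 1")
    case False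
    moreover have "m + n - 1 + p - 1 = m + p - 1 + n - 1" using i by simp
    ultimately show ?thesis by (simp only: diamond_at_def not_False_eq_True if_True)
  next
    case True
    then have "length as = (i + p - 1) + n + (m - i - 1)" using i j by simp
    then obtain pre' mg post where as: "as = pre' @ mg @ post" "length pre' = i + p - 1" "length mg = n"
        "length post = m - i - 1"
      using list_split3 by metis
    then have "length pre' = j + p + (i - j - 1)" using j by simp
    then obtain pre mid mid' where pre': "pre' = pre @ mid @ mid'" "length pre = j" "length mid = p"
        "length mid' = i - j - 1"
      using list_split3 by metis
    note fg = diamond_at_cochain[OF f g i]
    note hc = equivariant_cochain[OF h]
    have jm: "j < m" using i j by simp
    note fh = diamond_at_cochain[OF f hc jm]
    \<comment> \<open>\<open>f\<close> with \<open>g\<close> already inserted, as a function of the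
      arguments left of that block and of the coefficient still to be handed to
      \<open>g\<close>.\<close>
    let ?F = "\<lambda>c q d. f c (q @ g d mg # post)"
    have F: "linear sC sA (\<lambda>c. ?F c q d)" "A.multilinear (\<lambda>q. ?F c q d)" "linear sC sA (\<lambda>d. ?F c q d)"
      for c q d
      by (rule cochain_linear[OF f], rule A.multilinear_append_right[OF cochain_multilinear[OF f]],
        rule linear_comp[OF cochain_linear[OF g] linear_cochain_append[OF f]])
    have "diamond_at E (m + n - 1) p j (diamond_at E m n i f g) h c as
      = A.copr (\<lambda>c1 c2. pass E sA (\<lambda>bs d. diamond_at E m n i f g c1 ((bs @ h d mid # mid') @ mg @ post)) c2 pre) c"
      using diamond_at_append[OF fg, of pre j mid p h c "mid' @ mg @ post"] as pre' i j by simp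
    also have "\<dots> = A.copr (\<lambda>c1 c2. pass E sA (\<lambda>bs d. A.copr (\<lambda>c11 c12. pass E sA (?F c11) c12 (bs @ h d mid # mid')) c1) c2 pre) c"
      using as pre' j
      by (intro arg_cong[of _ _ "\<lambda>B. A.copr B c"] ext A.pass_cong diamond_at_append[OF f _ _ i] refl) auto
    also have "\<dots> = A.copr (\<lambda>c1 c2. pass E sA (\<lambda>bs e. pass E sA (\<lambda>bm e'. pass E sA (\<lambda>bs' d.
          A.copr (\<lambda>c11 c12. pass E sA (\<lambda>bs e. ?F c11 (bs @ h e bm # bs') d) c12 bs) c1) e' mid') e mid) c2 pre) c"
      using A.copr_pass_through[of ?F, OF F h pre'(3)] A.copr_pass_insert[of ?F, OF F h pre'(3)] by simp
    also have "\<dots> = A.copr (\<lambda>c1 c2. pass E sA (\<lambda>bs e. pass E sA (\<lambda>bm e'. pass E sA (\<lambda>bs' d.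
          diamond_at E m p j f h c1 (bs @ bm @ (bs' @ g d mg # post))) e' mid') e mid) c2 pre) c"
      using pre'
      by (intro arg_cong[of _ _ "\<lambda>B. A.copr B c"] ext A.pass_cong refl, subst diamond_at_append[OF f _ _ jm]) auto
    also have "\<dots> = diamond_at E (m + p - 1) n (i + p - 1) (diamond_at E m p j f h) g c as"
      using as pre' i j
      by (subst as(1), subst diamond_at_append[OF fh]) (auto simp: A.pass_append)
    finally show ?thesis .
  qed
qed

end

section \<open>Equivariance of composites\<close>

context entwining_target
begin

text \<open>Equivariance of \<open>f\<close> trades the twist of its value for a pass over its
  arguments. One of these is the value of \<open>g\<close>, and equivariance of \<open>g\<close>
  trades the twist of that value for a pass over \<open>mid\<close>.\<close>

lemma diamond_at_equivariant_aux:
  assumes f: "f \<in> equivariant_cochains E m" and g: "g \<in> equivariant_cochains E n" and i: "i < m"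
    and len: "length as = m + n - 1"
    and B: "\<And>y. linear sA s (\<lambda>x. B x y)" "\<And>x. linear sC s (\<lambda>y. B x y)"
  shows "copr (\<lambda>c1 c2. pass E s (\<lambda>bs d. B (diamond_at E m n i f g c1 bs) d) c2 as) c
    = copr (\<lambda>c1 c2. twist B c1 (diamond_at E m n i f g c2 as)) c"
proof -
  have "length as = i + n + (m - i - 1)" using i len by simp
  then obtain pre mid post where as: "as = pre @ mid @ post" "length pre = i" "length mid = n"
      "length post = m - i - 1"
    using list_split3 by metis
  note fc = equivariant_cochain[OF f] and gc = equivariant_cochain[OF g]
  \<comment> \<open>The final coefficient goes to the test map here, where in the parallel axiom it
    goes to the other inserted cochain.\<close>
  let ?F = "\<lambda>c q d. B (f c q) d"
  have F: "linear sC s (\<lambda>c. ?F c q d)" "multilinear (\<lambda>q. ?F c q d)" "linear sC s (\<lambda>d. ?F c q d)" for c q d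
    by (rule linear_cochain_comp[OF fc B(1)], rule multilinear_cochain_comp[OF fc B(1)], rule B)
  have tw: "linear sA s (\<lambda>x. twist B c x)" for c by (intro linear_intros B)
  have "copr (\<lambda>c1 c2. twist B c1 (diamond_at E m n i f g c2 as)) c
    = copr (\<lambda>c1 c2. copr (\<lambda>c21 c22. pass E s (\<lambda>bs d. twist B c1 (f c21 (bs @ g d mid # post))) c22 pre) c2) c"
    using as by (simp add: diamond_at_append[OF fc _ _ i] A.linear_copr_comp[OF tw entwining_target_axioms]
      A.linear_pass_comp[OF tw])
  \<comment> \<open>Coassociativity makes the twisting leg and the leg inside \<open>f\<close> two
    halves of \<open>c1\<close>, the shape in which equivariance of \<open>f\<close>
    applies.\<close>
  also have "\<dots> = copr (\<lambda>c1 c2. copr (\<lambda>c11 c12. pass E s (\<lambda>bs d. twist B c11 (f c12 (bs @ g d mid # post))) c2 pre) c1) c"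
  proof (rule coassoc[symmetric])
    have 1: "linear sA s (\<lambda>x. twist B u (f v (bs @ x # ys)))" for u v bs ys
      by (rule linear_comp[OF linear_cochain_append[OF fc] tw])
    show "linear sC s (\<lambda>x. pass E s (\<lambda>bs d. twist B x (f y (bs @ g d mid # post))) z pre)" for y z
      by (intro linear_intros B)
    show "linear sC s (\<lambda>y. pass E s (\<lambda>bs d. twist B x (f y (bs @ g d mid # post))) z pre)" for x z
      by (intro linear_pass_body linear_cochain_comp[OF fc tw])
    show "linear sC s (\<lambda>z. pass E s (\<lambda>bs d. twist B x (f y (bs @ g d mid # post))) z pre)" for x y
      by (intro linear_pass linear_cochain_comp[OF gc 1] multilinear_append_right[OF multilinear_cochain_comp[OF fc tw]])
  qed
  also have "\<dots> = copr (\<lambda>c1 c2. pass E s (\<lambda>bs d. copr (\<lambda>c11 c12. twist B c11 (f c12 (bs @ g d mid # post))) c1) c2 pre) c"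
    by (simp only: pass_copr)
  also have "\<dots> = copr (\<lambda>c1 c2. pass E s (\<lambda>bs d. copr (\<lambda>c11 c12. pass E s (?F c11) c12 (bs @ g d mid # post)) c1) c2 pre) c"
    using as i by (intro arg_cong[of _ _ "\<lambda>B. copr B c"] ext pass_cong equivariantD[OF f] refl B) auto
  also have "\<dots> = copr (\<lambda>c1 c2. pass E s (\<lambda>bs e. pass E s (\<lambda>bm e'. pass E s (\<lambda>bs' d.
          copr (\<lambda>c11 c12. pass E s (\<lambda>bs e. ?F c11 (bs @ g e bm # bs') d) c12 bs) c1) e' post) e mid) c2 pre) c"
    using copr_pass_through[of ?F, OF F g as(3)] copr_pass_insert[of ?F, OF F g as(3)] by simp
  also have "\<dots> = copr (\<lambda>c1 c2. pass E s (\<lambda>bs e. pass E s (\<lambda>bm e'. pass E s (\<lambda>bs' d.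
          B (diamond_at E m n i f g c1 (bs @ bm @ bs')) d) e' post) e mid) c2 pre) c"
    using as
    by (intro arg_cong[of _ _ "\<lambda>B. copr B c"] ext pass_cong refl, subst diamond_at_append[OF fc _ _ i])
      (auto simp: A.linear_copr_comp[OF B(1) entwining_target_axioms] A.linear_pass_comp[OF B(1)])
  also have "\<dots> = copr (\<lambda>c1 c2. pass E s (\<lambda>bs d. B (diamond_at E m n i f g c1 bs) d) c2 as) c"
    by (simp add: as(1) pass_append)
  finally show ?thesis by simp
qed

end

context entwining
begin

sublocale K: entwining_target E "(*)"
  using entwining_axioms vector_space_mult by (rule entwining_target.intro)

text \<open>The converse of \<open>equivariantD\<close> for the field as target: a functional
  killing the relations restricts on generators to a bilinear form, and such functionals separate
  cosets.\<close>

lemma equivariant_cochainsI: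
  assumes f: "f \<in> cochains E n"
    and eq: "\<And>B c as. length as = n \<Longrightarrow> (\<And>y. linear sA (*) (\<lambda>x. B x y)) \<Longrightarrow> (\<And>x. linear sC (*) (\<lambda>y. B x y))
      \<Longrightarrow> K.copr (\<lambda>c1 c2. pass E (*) (\<lambda>bs d. B (f c1 bs) d) c2 as) c
        = K.copr (\<lambda>c1 c2. K.twist B c1 (f c2 as)) c"
  shows "f \<in> equivariant_cochains E n"
proof -
  interpret F: entwining_target E free_scale
    using entwining_axioms vector_space_free_scale by (rule entwining_target.intro)
  have "F.copr (\<lambda>c1 c2. pass E free_scale (\<lambda>bs c'. gen (f c1 bs, c')) c2 as) c
      - F.copr (\<lambda>c1 c2. F.twist (\<lambda>x c'. gen (x, c')) c1 (f c2 as)) c \<in> AC_null E"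
    if len: "length as = n" for c as
    unfolding tensor_null_def
  proof (rule span_free_separate)
    fix \<phi> :: "('a \<times> 'c \<Rightarrow>\<^sub>0 'k) \<Rightarrow> 'k"
    assume \<phi>: "linear free_scale (*) \<phi>"
      and 0: "\<And>z. z \<in> {gen (v + v', w) - gen (v, w) - gen (v', w) | v v' w. True} \<union>
     {gen (v, w + w') - gen (v, w) - gen (v, w') | v w w'. True} \<union>
     {gen (sA r v, w) - free_scale r (gen (v, w)) | r v w. True} \<union>
     {gen (v, sC r w) - free_scale r (gen (v, w)) | r v w. True} \<Longrightarrow> \<phi> z = 0"
    interpret h: module_hom free_scale "(*)" \<phi> using \<phi> by (simp add: module_hom_iff_linear)
    have "\<phi> (gen (v + v', w) - gen (v, w) - gen (v', w)) = 0"
      "\<phi> (gen (v, w + w') - gen (v, w) - gen (v, w')) = 0"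
      "\<phi> (gen (sA r v, w) - free_scale r (gen (v, w))) = 0"
      "\<phi> (gen (v, sC r w) - free_scale r (gen (v, w))) = 0" for v v' w w' r
      by (rule 0, blast)+
    then have lin: "linear sA (*) (\<lambda>x. \<phi> (gen (x, y)))" "linear sC (*) (\<lambda>y. \<phi> (gen (x, y)))" for x y
      by (simp_all add: linear_iff vector_space_A vector_space_C vector_space_mult h.diff h.scale h.add diff_diff_eq)
    show "\<phi> (F.copr (\<lambda>c1 c2. pass E free_scale (\<lambda>bs c'. gen (f c1 bs, c')) c2 as) c)
      = \<phi> (F.copr (\<lambda>c1 c2. F.twist (\<lambda>x c'. gen (x, c')) c1 (f c2 as)) c)"
      using eq[OF len lin]
      by (simp add: F.linear_copr_comp[OF \<phi> K.entwining_target_axioms]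
        F.linear_twist_comp[OF \<phi> K.entwining_target_axioms] F.linear_pass_comp[OF \<phi>])
  qed
  then show ?thesis
    using f by (simp add: equivariant_cochains_def F.copr_def F.twist_def span_coset_eq_iff[OF tensor_null_def])
qed

lemma diamond_at_equivariant:
  assumes f: "f \<in> equivariant_cochains E m" and g: "g \<in> equivariant_cochains E n" and i: "i < m"
  shows "diamond_at E m n i f g \<in> equivariant_cochains E (m + n - 1)"
  using diamond_at_cochain[OF equivariant_cochain[OF f] equivariant_cochain[OF g] i]
    K.diamond_at_equivariant_aux[OF f g i]
  by (rule equivariant_cochainsI)

end

section \<open>Nonsymmetric operads with multiplication\<close>

text \<open>Signs act on bare abelian groups. Degree shifts \<open>n - 1\<close> will be written
  \<open>n + 1\<close> in the exponent, which has the same parity and avoids truncated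
  subtraction.\<close>

definition sg :: "nat \<Rightarrow> 'v::ab_group_add \<Rightarrow> 'v" where
  "sg k x = (if even k then x else - x)"

lemma sg_add: "sg k (x + y) = sg k x + sg k y"
  and sg_diff: "sg k (x - y) = sg k x - sg k y"
  and sg_sg: "sg k (sg l x) = sg (k + l) x"
  and sg_zero [simp]: "sg k 0 = 0"
  by (auto simp: sg_def)

lemma sg_sum: "sg k (sum f S) = (\<Sum>x\<in>S. sg k (f x))"
  by (simp add: sg_def sum_negf)

lemma sg_cong: "even k = even l \<Longrightarrow> sg k x = sg l x"
  by (simp add: sg_def)

lemma sum_lessThan_add:
  fixes f :: "nat \<Rightarrow> 'v::ab_group_add"
  shows "sum f {..<a + b} = sum f {..<a} + (\<Sum>l<b. f (a + l))"
  by (induction b) (simp_all add: add.assoc)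

lemma sum_lessThan_triangle:
  fixes a :: "nat \<Rightarrow> nat \<Rightarrow> 'v::ab_group_add"
  shows "(\<Sum>i<m. \<Sum>j<i. a i j) = (\<Sum>j<m. \<Sum>i=Suc j..<m. a i j)"
  by (induction m) (simp_all add: sum.distrib)

text \<open>\<open>P n\<close> is the group of \<open>n\<close>-ary operations and \<open>comp m n i f g\<close> inserts the \<open>n\<close>-ary \<open>g\<close> into
  the \<open>i\<close>-th argument (counted from \<open>0\<close>) of the \<open>m\<close>-ary \<open>f\<close>.\<close>

locale operad_with_multiplication =
  fixes P :: "nat \<Rightarrow> 'v::ab_group_add set"
    and comp :: "nat \<Rightarrow> nat \<Rightarrow> nat \<Rightarrow> 'v \<Rightarrow> 'v \<Rightarrow> 'v"
    and mu :: 'v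
  assumes zero_closed: "0 \<in> P n"
    and add_closed: "f \<in> P n \<Longrightarrow> g \<in> P n \<Longrightarrow> f + g \<in> P n"
    and minus_closed: "f \<in> P n \<Longrightarrow> - f \<in> P n"
    and comp_closed: "f \<in> P m \<Longrightarrow> g \<in> P n \<Longrightarrow> i < m \<Longrightarrow> comp m n i f g \<in> P (m + n - 1)"
    and comp_add_left: "f \<in> P m \<Longrightarrow> f' \<in> P m \<Longrightarrow> g \<in> P n \<Longrightarrow> i < m \<Longrightarrow>
      comp m n i (f + f') g = comp m n i f g + comp m n i f' g"
    and comp_add_right: "f \<in> P m \<Longrightarrow> g \<in> P n \<Longrightarrow> g' \<in> P n \<Longrightarrow> i < m \<Longrightarrow>
      comp m n i f (g + g') = comp m n i f g + comp m n i f g'"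
    and comp_nested: "f \<in> P m \<Longrightarrow> g \<in> P n \<Longrightarrow> h \<in> P p \<Longrightarrow> i < m \<Longrightarrow> l < n \<Longrightarrow>
      comp (m + n - 1) p (i + l) (comp m n i f g) h = comp m (n + p - 1) i f (comp n p l g h)"
    and comp_parallel: "f \<in> P m \<Longrightarrow> g \<in> P n \<Longrightarrow> h \<in> P p \<Longrightarrow> j < i \<Longrightarrow> i < m \<Longrightarrow>
      comp (m + n - 1) p j (comp m n i f g) h = comp (m + p - 1) n (i + p - 1) (comp m p j f h) g"
    and mu_closed: "mu \<in> P 2"
    and mu_assoc: "comp 2 2 0 mu mu = comp 2 2 1 mu mu"
begin

lemma diff_closed: "f \<in> P n \<Longrightarrow> g \<in> P n \<Longrightarrow> f - g \<in> P n"
  using add_closed[of f n "- g"] minus_closed[of g n] by simp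

lemma sg_closed: "f \<in> P n \<Longrightarrow> sg k f \<in> P n"
  by (simp add: sg_def minus_closed)

lemma sum_closed: "(\<And>x. x \<in> S \<Longrightarrow> f x \<in> P n) \<Longrightarrow> sum f S \<in> P n"
  by (induction S rule: infinite_finite_induct) (simp_all add: zero_closed add_closed)

lemma comp_zero_left: "g \<in> P n \<Longrightarrow> i < m \<Longrightarrow> comp m n i 0 g = 0"
  using comp_add_left[of 0 m 0 g n i] by (simp add: zero_closed)

lemma comp_zero_right: "f \<in> P m \<Longrightarrow> i < m \<Longrightarrow> comp m n i f 0 = 0"
  using comp_add_right[of f m 0 n 0 i] by (simp add: zero_closed)

lemma comp_minus_left: "f \<in> P m \<Longrightarrow> g \<in> P n \<Longrightarrow> i < m \<Longrightarrow> comp m n i (- f) g = - comp m n i f g"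
  using comp_add_left[of f m "- f" g n i]
  by (simp add: minus_closed comp_zero_left eq_neg_iff_add_eq_0 add.commute)

lemma comp_minus_right: "f \<in> P m \<Longrightarrow> g \<in> P n \<Longrightarrow> i < m \<Longrightarrow> comp m n i f (- g) = - comp m n i f g"
  using comp_add_right[of f m g n "- g" i]
  by (simp add: minus_closed comp_zero_right eq_neg_iff_add_eq_0 add.commute)

lemma comp_sg_left: "f \<in> P m \<Longrightarrow> g \<in> P n \<Longrightarrow> i < m \<Longrightarrow> comp m n i (sg k f) g = sg k (comp m n i f g)"
  and comp_sg_right: "f \<in> P m \<Longrightarrow> g \<in> P n \<Longrightarrow> i < m \<Longrightarrow> comp m n i f (sg k g) = sg k (comp m n i f g)"
  by (simp_all add: sg_def comp_minus_left comp_minus_right)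

lemma comp_sum_left:
  assumes "\<And>x. x \<in> S \<Longrightarrow> F x \<in> P m" "g \<in> P n" "i < m"
  shows "comp m n i (sum F S) g = (\<Sum>x\<in>S. comp m n i (F x) g)"
  using assms(1)
  by (induction S rule: infinite_finite_induct)
    (simp_all add: comp_zero_left comp_add_left sum_closed assms(2,3))

lemma comp_sum_right:
  assumes "\<And>x. x \<in> S \<Longrightarrow> F x \<in> P n" "f \<in> P m" "i < m"
  shows "comp m n i f (sum F S) = (\<Sum>x\<in>S. comp m n i f (F x))"
  using assms(1)
  by (induction S rule: infinite_finite_induct)
    (simp_all add: comp_zero_right comp_add_right sum_closed assms(2,3))

section \<open>The pre-Lie product and its associator\<close>

definition circ :: "nat \<Rightarrow> nat \<Rightarrow> 'v \<Rightarrow> 'v \<Rightarrow> 'v" where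
  "circ m n f g = (\<Sum>i<m. sg (i * (n + 1)) (comp m n i f g))"

text \<open>The brace f{g, h}: \<open>g\<close> enters argument \<open>i\<close> of \<open>f\<close>
  and \<open>h\<close> a later argument \<open>k\<close>. The insertion of \<open>g\<close> has
  moved that argument to \<open>k + n - 1\<close>, and this shift produces the summand
  \<open>(n + 1) * (p + 1)\<close> of the sign.\<close>

definition brace :: "nat \<Rightarrow> nat \<Rightarrow> nat \<Rightarrow> 'v \<Rightarrow> 'v \<Rightarrow> 'v \<Rightarrow> 'v" where
  "brace m n p f g h = (\<Sum>i<m. \<Sum>k=Suc i..<m. sg ((n + 1) * (p + 1) + i * (n + 1) + k * (p + 1))
     (comp (m + n - 1) p (k + n - 1) (comp m n i f g) h))"

lemma circ_closed: "f \<in> P m \<Longrightarrow> g \<in> P n \<Longrightarrow> circ m n f g \<in> P (m + n - 1)"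
  unfolding circ_def by (intro sum_closed sg_closed comp_closed) auto

lemma circ_arity_0 [simp]: "circ 0 n f g = 0"
  by (simp add: circ_def)

lemma circ_zero_right: "f \<in> P m \<Longrightarrow> circ m n f 0 = 0"
  by (simp add: circ_def comp_zero_right)

lemma circ_diff_left: "f \<in> P m \<Longrightarrow> f' \<in> P m \<Longrightarrow> g \<in> P n \<Longrightarrow> circ m n (f - f') g = circ m n f g - circ m n f' g"
  using comp_add_left[of f m "- f'" g n]
  by (simp add: circ_def minus_closed comp_minus_left sg_diff sum_subtractf)

lemma circ_diff_right: "f \<in> P m \<Longrightarrow> g \<in> P n \<Longrightarrow> g' \<in> P n \<Longrightarrow> circ m n f (g - g') = circ m n f g - circ m n f g'"
  using comp_add_right[of f m g n "- g'"]
  by (simp add: circ_def minus_closed comp_minus_right sg_diff sum_subtractf)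

lemma circ_sg_left: "f \<in> P m \<Longrightarrow> g \<in> P n \<Longrightarrow> circ m n (sg k f) g = sg k (circ m n f g)"
  by (simp add: circ_def comp_sg_left sg_sum sg_sg add.commute)

lemma circ_sg_right: "f \<in> P m \<Longrightarrow> g \<in> P n \<Longrightarrow> circ m n f (sg k g) = sg k (circ m n f g)"
  by (simp add: circ_def comp_sg_right sg_sum sg_sg add.commute)

text \<open>The arguments of a composite at \<open>i\<close> come before the block of
  \<open>g\<close>, inside it, or after it; the last are indexed by their original position
  \<open>k > i\<close> in \<open>f\<close>.\<close>

lemma sum_split3:
  fixes F :: "nat \<Rightarrow> 'v"
  assumes "i < m"
  shows "(\<Sum>j<m + n - 1. F j) = (\<Sum>j<i. F j) + (\<Sum>l<n. F (i + l)) + (\<Sum>k=Suc i..<m. F (k + n - 1))"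
proof -
  obtain r where m: "m = Suc i + r" using assms less_imp_Suc_add by (metis add_Suc)
  have "m + n - 1 = i + n + r" using m by simp
  moreover have "(\<Sum>k=Suc i..<m. F (k + n - 1)) = (\<Sum>l<r. F (i + n + l))"
    unfolding m by (rule sum.reindex_bij_witness[of _ "\<lambda>l. Suc i + l" "\<lambda>k. k - Suc i"]) (auto simp: ac_simps)
  ultimately show ?thesis by (simp add: sum_lessThan_add)
qed

text \<open>The graded pre-Lie identity. Insertions of \<open>h\<close> inside \<open>g\<close> give
  the iterated product by the nested axiom, those to the right of \<open>g\<close> are the brace.
  Those to its left become, by the parallel axiom, the brace with \<open>g\<close> and
  \<open>h\<close> exchanged.\<close>

lemma circ_associator:
  assumes f: "f \<in> P m" and g: "g \<in> P n" and h: "h \<in> P p"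
  shows "circ (m + n - 1) p (circ m n f g) h = circ m (n + p - 1) f (circ n p g h)
    + brace m n p f g h + sg ((n + 1) * (p + 1)) (brace m p n f h g)"
proof -
  let ?T = "\<lambda>i j. sg (j * (p + 1) + i * (n + 1)) (comp (m + n - 1) p j (comp m n i f g) h)"
  have "circ (m + n - 1) p (circ m n f g) h = (\<Sum>j<m + n - 1. \<Sum>i<m. ?T i j)"
  proof -
    have fg: "comp m n i f g \<in> P (m + n - 1)" if "i < m" for i
      using comp_closed[OF f g that] .
    have "sg (j * (p + 1)) (comp (m + n - 1) p j (\<Sum>i<m. sg (i * (n + 1)) (comp m n i f g)) h)
        = (\<Sum>i<m. ?T i j)" if j: "j < m + n - 1" for j
    proof (subst comp_sum_left[OF _ h j])
      show "sg (i * (n + 1)) (comp m n i f g) \<in> P (m + n - 1)" if "i \<in> {..<m}" for i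
        using that by (intro sg_closed fg) simp
      show "sg (j * (p + 1)) (\<Sum>i<m. comp (m + n - 1) p j (sg (i * (n + 1)) (comp m n i f g)) h) = (\<Sum>i<m. ?T i j)"
        unfolding sg_sum using comp_sg_left[OF fg h j]
        by (intro sum.cong refl) (simp add: sg_sg)
    qed
    then show ?thesis unfolding circ_def by (intro sum.cong refl) auto
  qed
  also have "\<dots> = (\<Sum>i<m. (\<Sum>j<i. ?T i j) + (\<Sum>l<n. ?T i (i + l)) + (\<Sum>k=Suc i..<m. ?T i (k + n - 1)))"
    by (subst sum.swap) (intro sum.cong refl, rule sum_split3, simp)
  also have "\<dots> = (\<Sum>i<m. \<Sum>j<i. ?T i j) + (\<Sum>i<m. \<Sum>l<n. ?T i (i + l)) + (\<Sum>i<m. \<Sum>k=Suc i..<m. ?T i (k + n - 1))"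
    by (simp add: sum.distrib)
  also have "(\<Sum>i<m. \<Sum>l<n. ?T i (i + l)) = circ m (n + p - 1) f (circ n p g h)"
  proof -
    have *: "?T i (i + l) = sg (i * (n + p - 1 + 1)) (comp m (n + p - 1) i f (sg (l * (p + 1)) (comp n p l g h)))"
      if "i < m" "l < n" for i l
    proof -
      have "?T i (i + l) = sg ((i + l) * (p + 1) + i * (n + 1)) (comp m (n + p - 1) i f (comp n p l g h))"
        using comp_nested[OF f g h that] by simp
      \<comment> \<open>The parities agree because \<open>l < n\<close> gives \<open>n > 0\<close>,
        so that \<open>n + p - 1 + 1\<close> is \<open>n + p\<close>.\<close>
      also have "\<dots> = sg (i * (n + p - 1 + 1) + l * (p + 1)) (comp m (n + p - 1) i f (comp n p l g h))"
        using that by (intro sg_cong) auto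
      finally show ?thesis
        by (simp only: comp_sg_right[OF f comp_closed[OF g h that(2)] that(1)] sg_sg)
    qed
    have "(\<Sum>l<n. ?T i (i + l)) = sg (i * (n + p - 1 + 1)) (comp m (n + p - 1) i f (circ n p g h))"
      if "i < m" for i
    proof -
      have "comp m (n + p - 1) i f (circ n p g h)
          = (\<Sum>l<n. comp m (n + p - 1) i f (sg (l * (p + 1)) (comp n p l g h)))"
        unfolding circ_def
        by (rule comp_sum_right[OF _ f that]) (intro sg_closed comp_closed[OF g h], simp)
      then show ?thesis using that * by (simp only: sg_sum) (intro sum.cong refl, simp only: lessThan_iff)
    qed
    then show ?thesis unfolding circ_def[of m] by (intro sum.cong refl) simp
  qed
  also have "(\<Sum>i<m. \<Sum>k=Suc i..<m. ?T i (k + n - 1)) = brace m n p f g h"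
    unfolding brace_def by (intro sum.cong refl sg_cong) auto
  also have "(\<Sum>i<m. \<Sum>j<i. ?T i j) = sg ((n + 1) * (p + 1)) (brace m p n f h g)"
  proof -
    have "(\<Sum>i<m. \<Sum>j<i. ?T i j) = (\<Sum>i<m. \<Sum>j<i. sg (j * (p + 1) + i * (n + 1))
        (comp (m + p - 1) n (i + p - 1) (comp m p j f h) g))"
      using comp_parallel[OF f g h] by (intro sum.cong refl) auto
    also have "\<dots> = (\<Sum>j<m. \<Sum>i=Suc j..<m. sg (j * (p + 1) + i * (n + 1))
        (comp (m + p - 1) n (i + p - 1) (comp m p j f h) g))"
      by (rule sum_lessThan_triangle)
    also have "\<dots> = sg ((n + 1) * (p + 1)) (brace m p n f h g)"
      unfolding brace_def sg_sum sg_sg by (intro sum.cong refl sg_cong) auto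
    finally show ?thesis .
  qed
  finally show ?thesis by (simp add: algebra_simps)
qed

section \<open>Differential, cup product and Gerstenhaber's identity\<close>

definition dif :: "nat \<Rightarrow> 'v \<Rightarrow> 'v" where
  "dif n f = sg (n + 1) (circ 2 n mu f) - circ n 2 f mu"

definition mcup :: "nat \<Rightarrow> nat \<Rightarrow> 'v \<Rightarrow> 'v \<Rightarrow> 'v" where
  "mcup m n f g = comp (m + 1) n m (comp 2 m 0 mu f) g"

lemma circ_mu: "circ 2 n mu f = comp 2 n 0 mu f + sg (n + 1) (comp 2 n 1 mu f)"
  by (simp add: circ_def numeral_2_eq_2 sg_def)

lemma dif_closed: "f \<in> P n \<Longrightarrow> dif n f \<in> P (n + 1)"
  using circ_closed[OF mu_closed, of f n] circ_closed[OF _ mu_closed, of f n]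
  by (simp add: dif_def diff_closed sg_closed)

lemma brace_mu: "brace 2 m n mu f g = sg (m * (n + 1)) (mcup m n f g)"
proof -
  \<comment> \<open>A binary operation admits only the pair i = 0, k = 1; the second insertion then
    happens at position 1 + m - 1 = m.\<close>
  have "{..<2::nat} = {0, 1}" by auto
  then have "brace 2 m n mu f g = sg ((m + 1) * (n + 1) + (n + 1)) (mcup m n f g)"
    by (simp add: brace_def mcup_def numeral_2_eq_2)
  also have "\<dots> = sg (m * (n + 1)) (mcup m n f g)" by (rule sg_cong) auto
  finally show ?thesis .
qed

text \<open>The two insertions of \<open>mu\<close> into itself carry opposite signs, so this is
  associativity, in the form of a Maurer-Cartan equation.\<close>

lemma circ_mu_mu: "circ 2 2 mu mu = 0"
  by (simp add: circ_mu mu_assoc sg_def)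

text \<open>The usual derivation from the graded Jacobi identity only yields twice the square.
  Expanding all products by the associator instead leaves brace terms that cancel in every
  characteristic.\<close>

lemma dif_dif:
  assumes f: "f \<in> P n"
  shows "dif (n + 1) (dif n f) = 0"
proof -
  note [simp] = f mu_closed
  have a: "circ 2 n mu f \<in> P (n + 1)" "circ n 2 f mu \<in> P (n + 1)"
    using circ_closed[OF mu_closed f] circ_closed[OF f mu_closed] by simp_all
  have "circ 2 (n + 1) mu (dif n f) = sg (n + 1) (circ 2 (n + 1) mu (circ 2 n mu f)) - circ 2 (n + 1) mu (circ n 2 f mu)"
    using a by (simp add: dif_def circ_diff_right circ_sg_right sg_closed)
  moreover have "circ (n + 1) 2 (dif n f) mu = sg (n + 1) (circ (n + 1) 2 (circ 2 n mu f) mu) - circ (n + 1) 2 (circ n 2 f mu) mu"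
    using a by (simp add: dif_def circ_diff_left circ_sg_left sg_closed)
  \<comment> \<open>The two braces of \<open>f\<close> with \<open>mu\<close> twice coincide and
    enter with opposite signs, as (2 + 1)(2 + 1) is odd.\<close>
  moreover have "circ (n + 1) 2 (circ n 2 f mu) mu = 0"
    using circ_associator[OF f mu_closed mu_closed] by (simp add: circ_mu_mu circ_zero_right sg_def)
  moreover have "circ (n + 1) 2 (circ 2 n mu f) mu = circ 2 (n + 1) mu (circ n 2 f mu)
      + brace 2 n 2 mu f mu + sg (n + 1) (brace 2 2 n mu mu f)"
    using circ_associator[OF mu_closed f mu_closed] by (simp add: sg_def)
  moreover have "0 = circ 2 (n + 1) mu (circ 2 n mu f) + brace 2 2 n mu mu f + sg (n + 1) (brace 2 n 2 mu f mu)"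
  proof -
    have "circ 3 n 0 f = 0" using circ_diff_left[of 0 3 0 f n] by (simp add: zero_closed)
    then show ?thesis
      using circ_associator[OF mu_closed mu_closed f] by (simp add: circ_mu_mu sg_def)
  qed
  then have "circ 2 (n + 1) mu (circ 2 n mu f) = - brace 2 2 n mu mu f - sg (n + 1) (brace 2 n 2 mu f mu)"
    by (simp add: algebra_simps eq_neg_iff_add_eq_0)
  ultimately show ?thesis
    unfolding dif_def[of "n + 1"] by (simp add: sg_def)
qed

theorem gerstenhaber_identity:
  assumes f: "f \<in> P m" and g: "g \<in> P n"
  shows "circ m (n + 1) f (dif n g) - dif (m + n - 1) (circ m n f g) + sg (n + 1) (circ (m + 1) n (dif m f) g)
    = sg (n + 1) (mcup n m g f - sg (m * n) (mcup m n f g))"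
proof -
  note [simp] = f g mu_closed
  have a: "circ 2 m mu f \<in> P (m + 1)" "circ m 2 f mu \<in> P (m + 1)"
    "circ 2 n mu g \<in> P (n + 1)" "circ n 2 g mu \<in> P (n + 1)"
    using circ_closed[OF mu_closed f] circ_closed[OF f mu_closed]
      circ_closed[OF mu_closed g] circ_closed[OF g mu_closed] by simp_all
  have 1: "circ m (n + 1) f (dif n g) = sg (n + 1) (circ m (n + 1) f (circ 2 n mu g)) - circ m (n + 1) f (circ n 2 g mu)"
    using a by (simp add: dif_def circ_diff_right circ_sg_right sg_closed)
  have 2: "circ (m + 1) n (dif m f) g = sg (m + 1) (circ (m + 1) n (circ 2 m mu f) g) - circ (m + 1) n (circ m 2 f mu) g"
    using a by (simp add: dif_def circ_diff_left circ_sg_left sg_closed)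
  \<comment> \<open>The exponent \<open>m + n - 1 + 1\<close> is \<open>m + n\<close> except for m =
    n = 0, where the product is 0 anyway.\<close>
  have 3: "dif (m + n - 1) (circ m n f g) = sg (m + n) (circ 2 (m + n - 1) mu (circ m n f g)) - circ (m + n - 1) 2 (circ m n f g) mu"
    by (cases m) (simp_all add: dif_def circ_zero_right)
  have 4: "circ (m + n - 1) 2 (circ m n f g) mu = circ m (n + 1) f (circ n 2 g mu) + brace m n 2 f g mu + sg (n + 1) (brace m 2 n f mu g)"
    using circ_associator[OF f g mu_closed] by (simp add: sg_def)
  have 5: "circ (m + 1) n (circ m 2 f mu) g = circ m (n + 1) f (circ 2 n mu g) + brace m 2 n f mu g + sg (n + 1) (brace m n 2 f g mu)"
    using circ_associator[OF f mu_closed g] by (simp add: sg_def)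
  have 6: "circ (m + 1) n (circ 2 m mu f) g = circ 2 (m + n - 1) mu (circ m n f g)
      + sg (m * (n + 1)) (mcup m n f g) + sg ((m + 1) * (n + 1) + n * (m + 1)) (mcup n m g f)"
    using circ_associator[OF mu_closed f g] by (simp add: brace_mu sg_sg)
  \<comment> \<open>The associators of (f, g, mu) and (f, mu, g) agree up to sign and cancel, as do
    the products of \<open>mu\<close> with \<open>circ m n f g\<close>. The braces of (mu, f, g)
    remain.\<close>
  show ?thesis
    unfolding 1 2 3 4 5 6 by (cases "even m"; cases "even n") (simp_all add: sg_def)
qed

end

section \<open>The operad of equivariant cochains\<close>

definition mult_cochain :: "('k::field, 'a::{ring,monoid_mult}, 'c::ab_group_add) entw \<Rightarrow> ('a, 'c) cochain" where
  "mult_cochain E = (\<lambda>c as. if length as = 2 then scA E (eps E c) (as ! 0 * as ! 1) else 0)"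

context entwining_target
begin

lemma linear_scale: "linear s s (s r)"
  by (simp add: linear_iff vector_space_axioms scale_right_distrib mult.commute)

lemma copr_add: "copr (\<lambda>x y. A x y + B x y) c = copr A c + copr B c"
  by (simp add: copr_def sweedler_def Let_def case_prod_unfold scale_right_distrib sum.distrib)

lemma twist_add: "twist (\<lambda>x y. A x y + B x y) c a = twist A c a + twist B c a"
  by (simp add: twist_def sweedler_def Let_def case_prod_unfold scale_right_distrib sum.distrib)

lemma pass_add: "pass E s (\<lambda>bs d. F bs d + G bs d) c as = pass E s F c as + pass E s G c as"
proof (induction as arbitrary: F G c)
  case (Cons a as)
  then show ?case by (simp only: pass_Cons twist_add)
qed simp

end

context entwining
begin

lemma mult_cochain_Cons [simp]: "mult_cochain E c [a, b] = sA (eps E c) (a * b)"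
  by (simp add: mult_cochain_def)

lemma mult_cochain_cochain: "mult_cochain E \<in> cochains E 2"
proof (rule cochainsI)
  show "linear sC sA (\<lambda>c. mult_cochain E c as)" for as
    using linear_eps by (auto simp: mult_cochain_def linear_iff vector_space_A A.scale_left_distrib)
next
  fix c and xs ys :: "'a list"
  assume "length xs + 1 + length ys = 2"
  then consider y where "xs = []" "ys = [y]" | x where "xs = [x]" "ys = []"
    by (cases xs; cases ys) auto
  then show "linear sA sA (\<lambda>a. mult_cochain E c (xs @ a # ys))"
    by cases (simp_all add: linear_iff vector_space_A distrib_left distrib_right A.scale_right_distrib
        scale_mult_left scale_mult_right mult.commute)
qed (simp add: mult_cochain_def)

text \<open>Both sides equal \<open>K.twist B c (a * b)\<close>: on the left the two successive
  twists merge by compatibility with products and \<epsilon> removes the first leg, on the right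
  \<epsilon> removes the second.\<close>

lemma mult_cochain_equivariant: "mult_cochain E \<in> equivariant_cochains E 2"
proof (rule equivariant_cochainsI[OF mult_cochain_cochain])
  fix B :: "'a \<Rightarrow> 'c \<Rightarrow> 'k" and c and as :: "'a list"
  assume "length as = 2"
  then obtain a b where as: "as = [a, b]"
    by (metis (no_types, opaque_lifting) length_0_conv length_Suc_conv numeral_2_eq_2)
  assume B: "linear sA (*) (\<lambda>x. B x y)" "linear sC (*) (\<lambda>y. B x y)" for x y
  let ?T = "\<lambda>c. K.twist (\<lambda>x d. K.twist (\<lambda>y. B (x * y)) d b) c a"
  have T: "?T c = K.twist B c (a * b)" for c
    by (rule K.twist_mult[OF B, symmetric])
  have lin: "linear sC (*) (\<lambda>c. K.twist B c (a * b))"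
    by (intro K.linear_intros B)
  have "K.copr (\<lambda>c1 c2. pass E (*) (\<lambda>bs d. B (mult_cochain E c1 bs) d) c2 as) c
      = K.copr (\<lambda>c1 c2. eps E c1 * ?T c2) c"
  proof -
    have "K.twist (\<lambda>x d. K.twist (\<lambda>y d'. B (sA r (x * y)) d') d b) c2 a = r * ?T c2" for r c2
      using B(1) by (simp add: linear_iff
          K.linear_twist_comp[OF K.linear_scale K.entwining_target_axioms])
    then show ?thesis by (simp add: as K.pass_Cons del: pass.simps(2))
  qed
  also have "\<dots> = K.twist B c (a * b)"
    unfolding T by (rule K.counit_left[OF lin])
  also have "\<dots> = K.copr (\<lambda>c1 c2. eps E c2 * K.twist B c1 (a * b)) c"
    by (rule K.counit_right[OF lin, symmetric])
  also have "\<dots> = K.copr (\<lambda>c1 c2. K.twist B c1 (mult_cochain E c2 as)) c"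
    using K.linear_twist_right[OF B] by (simp add: as linear_iff)
  finally show "K.copr (\<lambda>c1 c2. pass E (*) (\<lambda>bs d. B (mult_cochain E c1 bs) d) c2 as) c
      = K.copr (\<lambda>c1 c2. K.twist B c1 (mult_cochain E c2 as)) c" .
qed

text \<open>Valid for lists of any length, so that it can rewrite under \<open>pass\<close>, where
  the length of the bound list is not known.\<close>

lemma mult_diamond_0:
  assumes f: "f \<in> cochains E n"
  shows "diamond_at E 2 n 0 (mult_cochain E) f c (as @ [a]) = f c as * a"
proof (cases "length as = n")
  case True
  have "linear sC sA (\<lambda>c. f c as * a)"
    using cochain_linear[OF f, of as] by (simp add: linear_iff distrib_right scale_mult_left)
  from A.counit_left[OF this] show ?thesis
    using diamond_at_append[OF mult_cochain_cochain, of "[]" 0 as n f c "[a]"] True by simp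
qed (use cochain_eq_0[OF f] in \<open>simp add: diamond_at_def\<close>)

lemma mult_diamond_1:
  assumes f: "f \<in> cochains E n" and "length as = n"
  shows "diamond_at E 2 n 1 (mult_cochain E) f c (a # as) = A.twist (\<lambda>x d. x * f d as) c a"
proof -
  have 1: "linear sA sA (\<lambda>x. x * f d as)" for d
    by (simp add: linear_iff vector_space_A distrib_right scale_mult_left)
  have 2: "linear sC sA (\<lambda>d. x * f d as)" for x
    using cochain_linear[OF f, of as] by (simp add: linear_iff distrib_left scale_mult_right)
  have "linear sC sA (\<lambda>c. A.twist (\<lambda>x d. x * f d as) c a)"
    by (intro A.linear_intros 1 2)
  from A.counit_left[OF this] show ?thesis
    using diamond_at_append[OF mult_cochain_cochain, of "[a]" 1 as n f c "[]"] assms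
    by (simp add: A.pass_Cons A.linear_twist_comp[OF A.linear_scale A.entwining_target_axioms]
        del: pass.simps(2))
qed

text \<open>The inserted cochain contributes only \<epsilon> of the coefficient. By
  \<open>pass_eps\<close> this cancels all twists of \<open>pre\<close>, and the counit axiom then
  removes the second leg.\<close>

lemma diamond_mult:
  assumes f: "f \<in> cochains E n" and "length pre = i" "i < n"
  shows "diamond_at E n 2 i f (mult_cochain E) c (pre @ a # b # post) = f c (pre @ (a * b) # post)"
proof -
  have ml: "A.multilinear (\<lambda>bs. f c (bs @ (a * b) # post))" for c
    by (rule A.multilinear_append_right[OF cochain_multilinear[OF f]])
  have "f c (bs @ sA r (a * b) # post) = sA r (f c (bs @ (a * b) # post))" for r c bs
    using linear_cochain_append[OF f, of c bs post] by (simp add: linear_iff)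
  then show ?thesis
    using diamond_at_append[OF f assms(2) _ assms(3), of "[a, b]" 2 "mult_cochain E" c post]
    by (simp add: A.pass_eps[OF ml] A.counit_right[OF cochain_linear[OF f]])
qed

section \<open>The vector space of equivariant cochains\<close>

lemma minus_eq_scale_cochain: "- f = scale_cochain E (- 1) f"
  by (simp add: scale_cochain_def fun_eq_iff)

lemma cochain_add: "f \<in> cochains E n \<Longrightarrow> g \<in> cochains E n \<Longrightarrow> f + g \<in> cochains E n"
  by (simp add: cochains_def linear_iff A.scale_right_distrib)

lemma cochain_scale: "f \<in> cochains E n \<Longrightarrow> scale_cochain E r f \<in> cochains E n"
  by (simp add: cochains_def linear_iff A.scale_right_distrib scale_cochain_def mult.commute)

lemma equivariant_add:
  assumes f: "f \<in> equivariant_cochains E n" and g: "g \<in> equivariant_cochains E n"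
  shows "f + g \<in> equivariant_cochains E n"
proof (rule equivariant_cochainsI)
  show "f + g \<in> cochains E n" using f g by (simp add: cochain_add equivariant_cochain)
next
  fix B :: "'a \<Rightarrow> 'c \<Rightarrow> 'k" and c and as :: "'a list"
  assume len: "length as = n"
  assume B: "linear sA (*) (\<lambda>x. B x y)" "linear sC (*) (\<lambda>y. B x y)" for x y
  then show "K.copr (\<lambda>c1 c2. pass E (*) (\<lambda>bs d. B ((f + g) c1 bs) d) c2 as) c
      = K.copr (\<lambda>c1 c2. K.twist B c1 ((f + g) c2 as)) c"
    using K.equivariantD[OF f len B] K.equivariantD[OF g len B] K.linear_twist_right[OF B]
    by (simp add: linear_iff K.pass_add K.copr_add)
qed

lemma equivariant_scale:
  assumes f: "f \<in> equivariant_cochains E n"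
  shows "scale_cochain E r f \<in> equivariant_cochains E n"
proof (rule equivariant_cochainsI)
  show "scale_cochain E r f \<in> cochains E n" using f by (simp add: cochain_scale equivariant_cochain)
next
  fix B :: "'a \<Rightarrow> 'c \<Rightarrow> 'k" and c and as :: "'a list"
  assume len: "length as = n"
  assume B: "linear sA (*) (\<lambda>x. B x y)" "linear sC (*) (\<lambda>y. B x y)" for x y
  then show "K.copr (\<lambda>c1 c2. pass E (*) (\<lambda>bs d. B (scale_cochain E r f c1 bs) d) c2 as) c
      = K.copr (\<lambda>c1 c2. K.twist B c1 (scale_cochain E r f c2 as)) c"
    using K.equivariantD[OF f len B] K.linear_twist_right[OF B]
    by (simp add: linear_iff scale_cochain_def
        flip: K.linear_pass_comp[OF K.linear_scale] K.linear_copr_comp[OF K.linear_scale K.entwining_target_axioms])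
qed

lemma zero_equivariant: "0 \<in> equivariant_cochains E n"
proof (rule equivariant_cochainsI)
  show "0 \<in> cochains E n"
    by (simp add: cochains_def linear_iff vector_space_A vector_space_C)
next
  fix B :: "'a \<Rightarrow> 'c \<Rightarrow> 'k" and c and as :: "'a list"
  assume B: "linear sA (*) (\<lambda>x. B x y)" "linear sC (*) (\<lambda>y. B x y)" for x y
  have "B 0 d = 0" "K.twist B c 0 = 0" for d c
    using module_hom.zero[OF B(1)[folded module_hom_iff_linear]]
      module_hom.zero[OF K.linear_twist_right[OF B, folded module_hom_iff_linear]] by auto
  then show "K.copr (\<lambda>c1 c2. pass E (*) (\<lambda>bs d. B (0 c1 bs) d) c2 as) c
      = K.copr (\<lambda>c1 c2. K.twist B c1 (0 c2 as)) c"
    by simp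
qed

lemma diamond_at_add_left: "diamond_at E m n i (f + f') g = diamond_at E m n i f g + diamond_at E m n i f' g"
  by (simp add: diamond_at_def fun_eq_iff A.pass_add A.copr_add flip: A.copr_def)

lemma diamond_at_add_right:
  assumes f: "f \<in> cochains E m"
  shows "diamond_at E m n i f (g + g') = diamond_at E m n i f g + diamond_at E m n i f g'"
proof -
  have "f c (xs @ (x + y) # ys) = f c (xs @ x # ys) + f c (xs @ y # ys)" for c xs x y ys
    using linear_cochain_append[OF f] by (simp add: linear_iff)
  then show ?thesis
    by (simp add: diamond_at_def fun_eq_iff A.pass_add A.copr_add flip: A.copr_def)
qed

sublocale op: operad_with_multiplication "equivariant_cochains E" "diamond_at E" "mult_cochain E"
proof
  show "diamond_at E 2 2 0 (mult_cochain E) (mult_cochain E) = diamond_at E 2 2 1 (mult_cochain E) (mult_cochain E)"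
  proof (intro ext)
    fix c and as :: "'a list"
    consider x y z where "as = [x, y, z]" | "length as \<noteq> 3"
      by (cases as; cases "tl as"; cases "tl (tl as)"; cases "tl (tl (tl as))") auto
    then show "diamond_at E 2 2 0 (mult_cochain E) (mult_cochain E) c as
      = diamond_at E 2 2 1 (mult_cochain E) (mult_cochain E) c as"
    proof cases
      case 1
      \<comment> \<open>On the right-hand side \<open>x\<close> is still twisted by a coefficient of
        which only \<epsilon> is taken; \<open>twist_eps\<close> removes the twist and associativity
        of A remains.\<close>
      have "linear sA sA (\<lambda>x. x * (y * z))"
        by (simp add: linear_iff vector_space_A distrib_right scale_mult_left)
      then show ?thesis
        using 1 mult_diamond_0[OF mult_cochain_cochain, of c "[x, y]" z]
          mult_diamond_1[OF mult_cochain_cochain, of "[y, z]" c x] A.twist_eps[of "\<lambda>x. x * (y * z)" c x]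
        by (simp add: scale_mult_left scale_mult_right mult.assoc)
    qed (simp add: diamond_at_def)
  qed
qed (simp_all only: zero_equivariant equivariant_add equivariant_scale minus_eq_scale_cochain
  diamond_at_equivariant diamond_at_add_left diamond_at_add_right diamond_at_nested diamond_at_parallel
  equivariant_cochain mult_cochain_equivariant)

section \<open>Comparison with the operadic operations\<close>

lemma sg_eq_scale_cochain: "sg k f = scale_cochain E ((- 1) ^ k) f"
  by (simp add: sg_def scale_cochain_def fun_eq_iff)

text \<open>For n = 0 the exponent is negative when k > 0, hence the integer power; only its parity
  counts.\<close>

lemma powi_minus_one: "(- 1 :: 'k) powi (int k * (int n - 1)) = (- 1) ^ (k * (n + 1))"
  by (cases "even k"; cases "even n") (simp_all add: power_int_minus_left)

lemma diamond_eq_circ: "diamond E m n f g = op.circ m n f g"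
  by (simp only: diamond_def op.circ_def powi_minus_one sg_eq_scale_cochain)

lemma cup_eq_mcup:
  assumes f: "f \<in> equivariant_cochains E m" and g: "g \<in> equivariant_cochains E n"
  shows "cup E m n f g = op.mcup m n f g"
proof (intro ext)
  fix c as
  note mf = diamond_at_cochain[OF mult_cochain_cochain equivariant_cochain[OF f], of 0, simplified]
  show "cup E m n f g c as = op.mcup m n f g c as"
  proof (cases "length as = m + n")
    case True
    then have len: "length (take m as) = m" "length (drop m as) = n" by simp_all
    have "op.mcup m n f g c (take m as @ drop m as)
      = A.copr (\<lambda>c1 c2. pass E sA (\<lambda>bs d. diamond_at E 2 m 0 (mult_cochain E) f c1 (bs @ [g d (drop m as)])) c2 (take m as)) c"
      using diamond_at_append[OF mf len, of g c "[]"] by (simp add: op.mcup_def)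
    also have "\<dots> = cup E m n f g c as"
      using True by (simp add: mult_diamond_0[OF equivariant_cochain[OF f]] cup_def A.copr_def)
    finally show ?thesis by simp
  qed (simp add: cup_def op.mcup_def diamond_at_def)
qed

lemma differential_eq_dif:
  assumes "f \<in> equivariant_cochains E n"
  shows "differential E n f = op.dif n f"
proof (intro ext)
  fix c as
  note f = equivariant_cochain[OF assms]
  let ?m = "mult_cochain E"
  have dif: "op.dif n f = sg (n + 1) (diamond_at E 2 n 0 ?m f) + diamond_at E 2 n 1 ?m f
      + (\<Sum>i<n. sg (i + 1) (diamond_at E n 2 i f ?m))"
  proof -
    \<comment> \<open>In \<open>circ\<close> the sign at \<open>i\<close> has exponent 3i, of the
      parity of i; the minus sign in \<open>dif\<close> makes it i + 1.\<close>
    have "(\<Sum>i<n. sg (i + 1) (diamond_at E n 2 i f ?m)) = - op.circ n 2 f ?m"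
      unfolding op.circ_def sum_negf[symmetric] by (intro sum.cong refl) (simp add: sg_def)
    then show ?thesis by (simp add: op.dif_def op.circ_mu sg_add sg_sg) (simp add: sg_def)
  qed
  have sum: "(\<Sum>i<n. F i) c as = (\<Sum>i<n. F i c as)" for F :: "nat \<Rightarrow> ('a, 'c) cochain"
    by (induction n) simp_all
  show "differential E n f c as = op.dif n f c as"
  proof (cases "length as = n + 1")
    case False
    then show ?thesis by (simp add: differential_def dif sg_eq_scale_cochain scale_cochain_def sum diamond_at_def)
  next
    case True
    then have ne: "as \<noteq> []" by auto
    have "diamond_at E 2 n 0 ?m f c as = f c (butlast as) * last as"
      using mult_diamond_0[OF f, of c "butlast as" "last as"] ne by simp
    moreover have "diamond_at E 2 n 1 ?m f c as = sweedler sA (\<lambda>(x, c'). x * f c' (tl as)) (ent E c (hd as))"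
      using mult_diamond_1[OF f, of "tl as" c "hd as"] True ne by (simp add: A.twist_def)
    moreover have "diamond_at E n 2 i f ?m c as = f c (take i as @ (as ! i * as ! Suc i) # drop (i + 2) as)"
      if "i < n" for i
    proof -
      have "as = take i as @ as ! i # as ! Suc i # drop (i + 2) as"
        using that True by (simp add: Cons_nth_drop_Suc)
      then show ?thesis
        using diamond_mult[OF f _ that, of "take i as" c "as ! i" "as ! Suc i" "drop (i + 2) as"] that True
        by (simp add: min_def)
    qed
    moreover have "(\<Sum>i = 1..n. sA ((-1) ^ i) (f c (take (i - 1) as @ (as ! (i - 1) * as ! i) # drop (i + 1) as)))
        = (\<Sum>i<n. sA ((-1) ^ (i + 1)) (f c (take i as @ (as ! i * as ! Suc i) # drop (i + 2) as)))"
      by (rule sum.reindex_bij_witness[of _ Suc "\<lambda>i. i - 1"]) auto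
    ultimately show ?thesis
      using True by (simp add: differential_def dif sg_eq_scale_cochain scale_cochain_def sum add_ac)
  qed
qed

section \<open>Cohomology and graded commutativity\<close>

lemma dif_zero: "op.dif n 0 = 0"
  using op.circ_diff_left[OF zero_equivariant zero_equivariant mult_cochain_equivariant, of n]
  by (simp add: op.dif_def op.circ_zero_right mult_cochain_equivariant)

lemma dif_diff:
  assumes "f \<in> equivariant_cochains E n" "g \<in> equivariant_cochains E n"
  shows "op.dif n (f - g) = op.dif n f - op.dif n g"
  using assms
  by (simp add: op.dif_def op.circ_diff_left op.circ_diff_right mult_cochain_equivariant sg_diff)

lemma coboundaries_Suc: "coboundaries E (Suc n) = op.dif n ` equivariant_cochains E n"
  by (auto simp: coboundaries_def differential_eq_dif image_iff)

lemma zero_coboundary: "0 \<in> coboundaries E n"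
proof (cases n)
  case (Suc k)
  then show ?thesis using zero_equivariant dif_zero[of k] by (auto simp: coboundaries_Suc image_iff intro!: bexI[of _ 0])
qed (simp add: coboundaries_def)

lemma coboundaries_diff: "x \<in> coboundaries E n \<Longrightarrow> y \<in> coboundaries E n \<Longrightarrow> x - y \<in> coboundaries E n"
proof (cases n)
  case (Suc k)
  assume "x \<in> coboundaries E n" "y \<in> coboundaries E n"
  with Suc obtain h h' where h: "h \<in> equivariant_cochains E k" "h' \<in> equivariant_cochains E k"
      and "x = op.dif k h" "y = op.dif k h'"
    by (auto simp: coboundaries_Suc)
  then have "x - y = op.dif k (h - h')" by (simp add: dif_diff)
  with Suc show ?thesis using op.diff_closed[OF h] by (simp add: coboundaries_Suc)
qed (simp add: coboundaries_def)

lemma coboundaries_sg: "x \<in> coboundaries E n \<Longrightarrow> sg k x \<in> coboundaries E n"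
  using coboundaries_diff[OF zero_coboundary, of x n] by (simp add: sg_def)

lemma cocycles_iff: "f \<in> cocycles E n \<longleftrightarrow> f \<in> equivariant_cochains E n \<and> op.dif n f = 0"
  by (auto simp: cocycles_def differential_eq_dif)

lemma cocycle_add_coboundary:
  assumes f: "f \<in> cocycles E n" and b: "b \<in> coboundaries E n"
  shows "f + b \<in> cocycles E n"
proof -
  have b: "b \<in> equivariant_cochains E n \<and> op.dif n b = 0"
  proof (cases n)
    case 0
    then show ?thesis using b by (simp add: coboundaries_def zero_equivariant dif_zero)
  next
    case (Suc k)
    then obtain h where h: "h \<in> equivariant_cochains E k" "b = op.dif k h"
      using b by (auto simp: coboundaries_Suc)
    then show ?thesis using op.dif_closed[OF h(1)] op.dif_dif[OF h(1)] Suc by simp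
  qed
  from f have f: "f \<in> equivariant_cochains E n" "op.dif n f = 0" by (auto simp: cocycles_iff)
  have "op.dif n (f + b - b) = op.dif n (f + b) - op.dif n b"
    by (rule dif_diff) (use f b in \<open>simp_all add: op.add_closed\<close>)
  then show ?thesis using f b by (simp add: cocycles_iff op.add_closed)
qed

text \<open>The product of classes is a union over all representatives, so commutativity has to be
  available for each of them.\<close>

lemma cohomology_subset_cocycles:
  assumes "\<xi> \<in> cohomology E n"
  shows "\<xi> \<subseteq> cocycles E n"
  using assms cocycle_add_coboundary
  by (auto simp: cohomology_def elt_set_plus_def)

text \<open>For cocycles, Gerstenhaber's identity retains only the differential of
  \<open>op.circ m n f g\<close>, which therefore bounds the graded commutator up to sign.\<close>

lemma cup_commute_coboundary:
  assumes "f \<in> cocycles E m" "g \<in> cocycles E n"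
  shows "cup E m n f g - sg (m * n) (cup E n m g f) \<in> coboundaries E (m + n)"
proof -
  from assms have f: "f \<in> equivariant_cochains E m" "op.dif m f = 0"
    and g: "g \<in> equivariant_cochains E n" "op.dif n g = 0"
    by (auto simp: cocycles_iff)
  have "op.circ (m + 1) n 0 g = 0"
    using op.circ_diff_left[OF zero_equivariant zero_equivariant g(1)] by simp
  with op.gerstenhaber_identity[OF f(1) g(1)] f g
  have *: "- op.dif (m + n - 1) (op.circ m n f g)
      = sg (n + 1) (op.mcup n m g f - sg (m * n) (op.mcup m n f g))"
    by (simp add: op.circ_zero_right)
  have "cup E m n f g - sg (m * n) (cup E n m g f)
      = sg (m * n + n + 1) (op.dif (m + n - 1) (op.circ m n f g))"
    unfolding cup_eq_mcup[OF f(1) g(1)] cup_eq_mcup[OF g(1) f(1)]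
    using arg_cong[OF *, of "sg (m * n + n)"]
    by (cases "even m"; cases "even n") (simp_all add: sg_def algebra_simps)
  moreover have "op.dif (m + n - 1) (op.circ m n f g) \<in> coboundaries E (m + n)"
  proof (cases "m + n")
    \<comment> \<open>In degree 0 only 0 is a coboundary, and m = 0 makes the product vanish, so the
      truncated \<open>m + n - 1\<close> does no harm.\<close>
    case 0
    then show ?thesis by (simp add: dif_zero coboundaries_def)
  next
    case (Suc k)
    then show ?thesis using op.circ_closed[OF f(1) g(1)] by (simp add: coboundaries_Suc)
  qed
  ultimately show ?thesis by (simp add: coboundaries_sg)
qed

end

theorem theorem5p2:
  fixes E :: "('k::field, 'a::{ring,monoid_mult}, 'c::ab_group_add) entw"
  assumes "entwining_structure E"
  shows "(\<forall>m n. \<forall>f \<in> equivariant_cochains E m. \<forall>g \<in> equivariant_cochains E n.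
      diamond E m (n + 1) f (differential E n g) - differential E (m + n - 1) (diamond E m n f g)
        + scale_cochain E ((-1) powi (int n - 1)) (diamond E (m + 1) n (differential E m f) g)
      = scale_cochain E ((-1) powi (int n - 1))
          (cup E n m g f - scale_cochain E ((-1) ^ (m * n)) (cup E m n f g)))
    \<and> (\<forall>m n. \<forall>\<xi> \<in> cohomology E m. \<forall>\<eta> \<in> cohomology E n.
      cohomology_cup E m n \<xi> \<eta>
      = cohomology_scale E (m + n) ((-1) ^ (m * n)) (cohomology_cup E n m \<eta> \<xi>))"
proof (intro conjI allI ballI)
  interpret entwining E by standard (rule assms)
  fix m n :: nat and f g
  assume f: "f \<in> equivariant_cochains E m" and g: "g \<in> equivariant_cochains E n"
  have "(-1 :: 'k) powi (int n - 1) = (-1) ^ (n + 1)" using powi_minus_one[of 1 n] by simp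
  then have sc: "scale_cochain E ((-1) powi (int n - 1)) = sg (n + 1)"
    by (simp only: sg_eq_scale_cochain[abs_def])
  have "op.circ m n f g \<in> equivariant_cochains E (m + n - 1)" by (rule op.circ_closed[OF f g])
  then show "diamond E m (n + 1) f (differential E n g) - differential E (m + n - 1) (diamond E m n f g)
        + scale_cochain E ((-1) powi (int n - 1)) (diamond E (m + 1) n (differential E m f) g)
      = scale_cochain E ((-1) powi (int n - 1))
          (cup E n m g f - scale_cochain E ((-1) ^ (m * n)) (cup E m n f g))"
    unfolding sc sg_eq_scale_cochain[symmetric] diamond_eq_circ
    using op.gerstenhaber_identity[OF f g]
    by (simp only: differential_eq_dif f g cup_eq_mcup)
next
  interpret entwining E by standard (rule assms)
  fix m n :: nat and \<xi> \<eta>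
  assume \<xi>: "\<xi> \<in> cohomology E m" and \<eta>: "\<eta> \<in> cohomology E n"
  let ?B = "coboundaries E (m + n)"
  note coset_eq = coset_eq_iff[of ?B, OF zero_coboundary coboundaries_diff]
  \<comment> \<open>For a fixed pair of representatives, every coset in the scaled union is already
    that of \<open>cup E m n f g\<close>. The two products of classes then differ only in the order
    of the unions over \<xi> and \<eta>.\<close>
  have "(\<Union>x\<in>cup E n m g f +o ?B. sg (m * n) x +o ?B) = cup E m n f g +o ?B"
    if "f \<in> \<xi>" "g \<in> \<eta>" for f g
  proof -
    have *: "sg (m * n) (cup E n m g f + b) +o ?B = cup E m n f g +o ?B" if b: "b \<in> ?B" for b
    proof -
      have "sg (m * n) b - (cup E m n f g - sg (m * n) (cup E n m g f)) \<in> ?B"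
        using cohomology_subset_cocycles[OF \<xi>] cohomology_subset_cocycles[OF \<eta>] \<open>f \<in> \<xi>\<close> \<open>g \<in> \<eta>\<close> b
        by (intro coboundaries_diff coboundaries_sg cup_commute_coboundary) auto
      then show ?thesis by (simp add: coset_eq sg_add algebra_simps)
    qed
    have "sg (m * n) x +o ?B = cup E m n f g +o ?B" if "x \<in> cup E n m g f +o ?B" for x
    proof -
      from that obtain b where "b \<in> ?B" "x = cup E n m g f + b" by (auto simp: elt_set_plus_def)
      then show ?thesis using * by simp
    qed
    moreover have "cup E n m g f \<in> cup E n m g f +o ?B"
      using set_plus_intro2[OF zero_coboundary, of "cup E n m g f"] by simp
    ultimately show ?thesis by blast
  qed
  then have "(\<Union>g\<in>\<eta>. \<Union>f\<in>\<xi>. \<Union>x\<in>cup E n m g f +o ?B. sg (m * n) x +o ?B)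
      = (\<Union>g\<in>\<eta>. \<Union>f\<in>\<xi>. cup E m n f g +o ?B)"
    by (intro SUP_cong refl)
  also have "\<dots> = (\<Union>f\<in>\<xi>. \<Union>g\<in>\<eta>. cup E m n f g +o ?B)"
    by (rule SUP_commute)
  finally show "cohomology_cup E m n \<xi> \<eta>
      = cohomology_scale E (m + n) ((-1) ^ (m * n)) (cohomology_cup E n m \<eta> \<xi>)"
    unfolding cohomology_cup_def cohomology_scale_def quot_scale_def sg_eq_scale_cochain[symmetric]
      add.commute[of n m]
    by (simp only: UN_UN_flatten)
qed

end
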